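(* Let $\phi=f+h$ on $\mathbb{R}^n$, where $f:\mathbb{R}^n\to\mathbb{R}$ is convex and differentiable with gradient Lipschitz continuous with constant $L>0$, and $h(x)=\max_{v\in Q}v^TAx$, where $Q\subset\mathbb{R}^m$ is a nonempty compact convex set and $A\in\mathbb{R}^{m\times n}$ is a nonzero matrix. Let $d$ be a smooth, nonnegative function on $Q$ that is strongly convex on $Q$ with strong convexity parameter $c>0$ (with respect to the Euclidean norm), and let $M=\max_{v\in Q}d(v)$. Suppose the stochastic gradient $G(x,\xi)$ satisfies $\mathbb{E}\,G(x,\xi)=\nabla f(x)$ and $\mathbb{E}\|\nabla f(x)-G(x,\xi)\|^2\le\sigma^2$ for all $x\in\mathbb{R}^n$, where $\sigma\geq0$ is a constant. Let $x^*$ be an optimal solution of $\min_x\phi(x)$ and let $N\ge1$ be an integer. If Algorithm SSG (defined in the context) is run with inputs $N$, $L$ and $\mu=\frac{\|A\|}{N+2}$, then its output $x_{N+1}$ satisfies $$\mathbb{E}\,\phi(x_{N+1})-\phi(x^* )\leq\frac{2D^2+\sigma^2}{(N+2)^{\frac{1}{2}}}+L\,\frac{4D^2+2\sigma^2}{(N+2)^2}+\frac{\|A\|}{N+2}\left(M+\frac{4D^2+2\sigma^2}{c}\right),$$ where $D=\|x^*-z_0\|$ and $z_0=0$ is the starting point of the algorithm.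
   Context: Here $\|\cdot\|$ on vectors is the Euclidean norm, $\langle\cdot,\cdot\rangle$ is the Euclidean inner product, and $\|A\|=\max_{\|x\|=1,\|y\|=1}y^TAx$ is the spectral norm. The function $f$ is of the form $f(x)=\mathbb{E}F(x,\xi)$ for a random variable $\xi$, and $G(x,\xi)$ is a random vector in $\mathbb{R}^n$ determined by $x$ and $\xi$ (a stochastic gradient of $f$ at $x$); expectations in the hypotheses on $G$ are over $\xi$, with $x$ fixed. For $\mu>0$ put $h_\mu(x)=\max_{v\in Q}\{v^TAx-\mu d(v)\}$, and let $v_\mu(x)$ denote the unique maximizer. Algorithm SSG (inputs: $N$, $L$ and $\mu>0$). Set $L_\mu=L+\frac{1}{c\mu}\|A\|^2$, and $\theta_t=\frac{2}{t+2}$, $\gamma_t=\frac{2}{t+2}\left(\frac{N^{3/2}}{L_\mu}+2\right)$ for $t=0,1,\dots,N$. Set $x_0=0$ and $z_0=0$. For $t=0,1,\dots,N$: 1. $y_t=(1-\theta_t)x_t+\theta_t z_t$; 2. $v_\mu(y_t)=\operatorname{arg\,max}_{v\in Q}\{v^TAy_t-\mu d(v)\}$; 3. generate $\xi_t$ from the distribution of $\xi$, independently of the previously generated $\xi_0,\dots,\xi_{t-1}$; 4. $z_{t+1}=\operatorname{arg\,min}_{x\in\mathbb{R}^n}\left\{\langle x,G(y_t,\xi_t)+A^Tv_\mu(y_t)\rangle+\frac{\gamma_t L_\mu}{2}\|x-z_t\|^2\right\}$; 5. $x_{t+1}=(1-\theta_t)x_t+\theta_t z_{t+1}$. Output: $x_{N+1}$.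 The expectation in the conclusion is over $\xi_0,\dots,\xi_N$. *)

theory Defs
  imports "HOL-Probability.Probability"
begin

definition spectral_norm :: "real^'n^'m \<Rightarrow> real" where
  "spectral_norm A =
     (SUP (x, y) \<in> sphere 0 1 \<times> sphere 0 1. y \<bullet> (A *v x))"

lemma spectral_norm_eq_onorm:
  fixes A :: "real^'n^'m"
  shows "spectral_norm A = onorm ((*v) A)"
proof (rule antisym)
  let ?S = "sphere (0::real^'n) 1 \<times> sphere (0::real^'m) 1"
  have bl: "bounded_linear ((*v) A)"
    by (rule matrix_vector_mul_bounded_linear)
  have bound: "y \<bullet> (A *v x) \<le> onorm ((*v) A)" if "(x, y) \<in> ?S" for x y
  proof -
    have "y \<bullet> (A *v x) \<le> norm y * norm (A *v x)"
      by (rule norm_cauchy_schwarz)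
    also have "\<dots> \<le> onorm ((*v) A)"
      using onorm[OF bl, of x] that by simp
    finally show ?thesis .
  qed
  obtain x0 :: "real^'n" where x0: "norm x0 = 1"
    using vector_choose_size zero_le_one by blast
  obtain y0 :: "real^'m" where y0: "norm y0 = 1"
    using vector_choose_size zero_le_one by blast
  show "spectral_norm A \<le> onorm ((*v) A)"
    unfolding spectral_norm_def
  proof (rule cSUP_least)
    show "?S \<noteq> {}" using x0 y0 by auto
  qed (use bound in auto)
  have bdd: "bdd_above ((\<lambda>(x, y). y \<bullet> (A *v x)) ` ?S)"
    using bound by (intro bdd_aboveI2[where M = "onorm ((*v) A)"]) auto
  have le: "y \<bullet> (A *v x) \<le> spectral_norm A" if "norm x = 1" "norm y = 1" for x y
    unfolding spectral_norm_def using cSUP_upper[OF _ bdd, of "(x, y)"] that by simp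
  show "onorm ((*v) A) \<le> spectral_norm A"
  proof (rule onorm_le)
    fix x
    show "norm (A *v x) \<le> spectral_norm A * norm x"
    proof (cases "x = 0")
      case False
      define u where "u = x /\<^sub>R norm x"
      have u: "norm u = 1" "A *v u = (A *v x) /\<^sub>R norm x"
        using False by (simp_all add: u_def matrix_vector_mult_scaleR)
      have "norm (A *v u) \<le> spectral_norm A"
      proof (cases "A *v u = 0")
        case True
        then show ?thesis using le[OF u(1) y0] by simp
      next
        case nz: False
        have "((A *v u) /\<^sub>R norm (A *v u)) \<bullet> (A *v u) = norm (A *v u)"
          using nz by (simp add: dot_square_norm power2_eq_square)
        then show ?thesis
          using le[OF u(1), of "(A *v u) /\<^sub>R norm (A *v u)"] nz by simp
      qed
      then show ?thesis
        using False by (simp add: u(2) field_simps)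
    qed simp
  qed
qed

definition strongly_convex_on :: "'a::real_inner set \<Rightarrow> real \<Rightarrow> ('a \<Rightarrow> real) \<Rightarrow> bool" where
  "strongly_convex_on S c d \<longleftrightarrow> convex S \<and>
     (\<forall>u\<in>S. \<forall>v\<in>S. \<forall>t\<in>{0..1}.
        d ((1 - t) *\<^sub>R u + t *\<^sub>R v)
          \<le> (1 - t) * d u + t * d v - c / 2 * t * (1 - t) * (norm (u - v))\<^sup>2)"

text \<open>
  Smoothness of a function on a set that may have empty interior is understood as continuous
  differentiability relative to the set.
\<close>

definition cont_differentiable_on :: "('a::real_inner \<Rightarrow> real) \<Rightarrow> 'a set \<Rightarrow> bool" where
  "cont_differentiable_on d S \<longleftrightarrow>
     (\<exists>g. continuous_on S g \<and> (\<forall>v\<in>S. (d has_derivative (\<lambda>w. w \<bullet> g v)) (at v within S)))"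

definition v_smooth :: "real^'n^'m \<Rightarrow> (real^'m) set \<Rightarrow> (real^'m \<Rightarrow> real) \<Rightarrow> real \<Rightarrow> real^'n \<Rightarrow> real^'m" where
  "v_smooth A Q d \<mu> x = arg_max_on (\<lambda>v. v \<bullet> (A *v x) - \<mu> * d v) Q"

definition L_smooth :: "real^'n^'m \<Rightarrow> real \<Rightarrow> real \<Rightarrow> real \<Rightarrow> real" where
  "L_smooth A c L \<mu> = L + 1 / (c * \<mu>) * (spectral_norm A)\<^sup>2"

definition \<theta>_step :: "nat \<Rightarrow> real" where
  "\<theta>_step t = 2 / (real t + 2)"

definition \<gamma>_step :: "nat \<Rightarrow> real \<Rightarrow> nat \<Rightarrow> real" where
  "\<gamma>_step N L\<^sub>\<mu> t = 2 / (real t + 2) * (real N powr (3/2) / L\<^sub>\<mu> + 2)"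

text \<open>
  The state after \<open>t\<close> iterations is the pair \<open>(x\<^sub>t, z\<^sub>t)\<close>; \<open>s t\<close> is the sample drawn
  in iteration \<open>t\<close>.
\<close>

primrec ssg ::
  "real^'n^'m \<Rightarrow> (real^'m) set \<Rightarrow> (real^'m \<Rightarrow> real) \<Rightarrow> real \<Rightarrow> (real^'n \<Rightarrow> 's \<Rightarrow> real^'n)
     \<Rightarrow> nat \<Rightarrow> real \<Rightarrow> real \<Rightarrow> (nat \<Rightarrow> 's) \<Rightarrow> nat \<Rightarrow> (real^'n) \<times> (real^'n)" where
  "ssg A Q d c G N L \<mu> s 0 = (0, 0)"
| "ssg A Q d c G N L \<mu> s (Suc t) =
     (let (x, z) = ssg A Q d c G N L \<mu> s t;
          L\<^sub>\<mu> = L_smooth A c L \<mu>;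
          y = (1 - \<theta>_step t) *\<^sub>R x + \<theta>_step t *\<^sub>R z;
          v = v_smooth A Q d \<mu> y;
          z' = arg_min (\<lambda>u. u \<bullet> (G y (s t) + transpose A *v v)
                            + \<gamma>_step N L\<^sub>\<mu> t * L\<^sub>\<mu> / 2 * (norm (u - z))\<^sup>2) (\<lambda>u. True);
          x' = (1 - \<theta>_step t) *\<^sub>R x + \<theta>_step t *\<^sub>R z'
      in (x', z'))"

definition ssg_output ::
  "real^'n^'m \<Rightarrow> (real^'m) set \<Rightarrow> (real^'m \<Rightarrow> real) \<Rightarrow> real \<Rightarrow> (real^'n \<Rightarrow> 's \<Rightarrow> real^'n)
     \<Rightarrow> nat \<Rightarrow> real \<Rightarrow> real \<Rightarrow> (nat \<Rightarrow> 's) \<Rightarrow> real^'n" where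
  "ssg_output A Q d c G N L \<mu> s = fst (ssg A Q d c G N L \<mu> s (N + 1))"

end

theory Submission
  imports Defs
begin

text \<open>
  Replacing \<open>h\<close> by its smoothing \<open>h\<^sub>\<mu>\<close> changes it by at most \<open>\<mu> M\<close> and makes \<open>\<Phi> = f + h\<^sub>\<mu>\<close> convex with
  an \<open>L\<^sub>\<mu>\<close>-Lipschitz gradient (\<open>smoothed_gderiv\<close>, \<open>smoothed_gradient_lipschitz\<close>). The algorithm is then
  an accelerated stochastic gradient iteration on \<open>\<Phi>\<close> whose proximal parameter in step \<open>t\<close> is
  \<open>\<theta>\<^sub>t B\<close> with \<open>B = N\<^bsup>3/2\<^esup> + 2 L\<^sub>\<mu>\<close>. Large steps would be punished by the noise, and the term
  \<open>N\<^bsup>3/2\<^esup>\<close> damps them just enough to balance bias and variance after \<open>N\<close> steps.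

  The delicate point is that the comparison point \<open>x\<^sup>*\<close> minimizes \<open>f + h\<close> and not \<open>\<Phi>\<close>, so
  \<open>\<Phi> x\<^sub>t - \<Phi> x\<^sup>*\<close> may be negative, by as much as \<open>\<mu> M\<close>. The textbook weights \<open>1 / \<theta>\<^sub>t\<^sup>2 = (t + 2)\<^sup>2 / 4\<close>
  satisfy the required recursion only with a defect of \<open>1 / 4\<close>, which is harmless for nonnegative gaps
  only; here it would spoil the factor \<open>1\<close> in front of \<open>\<mu> M\<close>. The remedy is to compare each step with
  \<open>x\<^sup>*\<close> and, with a small extra weight, with the current iterate \<open>x\<^sub>t\<close>. With \<open>w\<^sub>t = t (t + 3) / 4\<close> the
  potential
  \<open>w\<^sub>t (\<Phi> x\<^sub>t - \<Phi> x\<^sup>*) + (B / 2) (norm (z\<^sub>t - x\<^sup>*))\<^sup>2 + (B / 2) (t / (t + 2)\<^sup>2) (norm (z\<^sub>t - x\<^sub>t))\<^sup>2\<close>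
  is nonincreasing up to noise, without any sign condition (\<open>potential_step\<close>), and
  \<open>w\<^sub>N\<^sub>+\<^sub>1 \<ge> (N + 2)\<^sup>2 / 4\<close>.

  In expectation the terms linear in the gradient error vanish, since the error has mean zero given the
  past (\<open>error_uncorrelated\<close>), and the quadratic ones add \<open>w\<^sub>t\<^sub>+\<^sub>1 (B + L\<^sub>\<mu>) \<sigma>\<^sup>2 / (2 B\<^sup>2)\<close> per step. In
  the last step only the curvature part \<open>w\<^sub>N\<^sub>+\<^sub>1 L\<^sub>\<mu> \<sigma>\<^sup>2 / (2 B\<^sup>2)\<close> is charged, as the final displacement
  of \<open>z\<close> is discarded (\<open>expected_suboptimality\<close>). Dividing by \<open>w\<^sub>N\<^sub>+\<^sub>1\<close>, inserting \<open>\<mu>\<close> and adding \<open>\<mu> M\<close>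
  gives the claim (\<open>rate_arithmetic\<close>).
\<close>

section \<open>Convex functions with Lipschitz gradient\<close>

lemma gderiv_along_line:
  assumes "\<And>x. GDERIV f x :> g x"
  shows "((\<lambda>t. f (x + t *\<^sub>R v)) has_real_derivative g (x + t *\<^sub>R v) \<bullet> v) (at t)"
proof -
  have "((\<lambda>t. x + t *\<^sub>R v) has_derivative (\<lambda>s. s *\<^sub>R v)) (at t)"
    by (auto intro!: derivative_eq_intros)
  moreover have "(f has_derivative (\<lambda>h. h \<bullet> g (x + t *\<^sub>R v))) (at (x + t *\<^sub>R v))"
    using assms by (simp add: gderiv_def)
  ultimately have "((\<lambda>t. f (x + t *\<^sub>R v)) has_derivative (\<lambda>s. (s *\<^sub>R v) \<bullet> g (x + t *\<^sub>R v))) (at t)"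
    by (rule has_derivative_compose)
  then show ?thesis
    by (simp add: has_field_derivative_def inner_commute mult_commute_abs)
qed

lemma convex_gradient_minorant:
  assumes "convex_on UNIV f" and "\<And>x. GDERIV f x :> g x"
  shows "f x + g x \<bullet> (u - x) \<le> f u"
proof -
  let ?p = "\<lambda>t. f (x + t *\<^sub>R (u - x))"
  have "convex_on UNIV ?p"
  proof (rule convex_onI)
    fix t a b :: real
    assume "0 < t" "t < 1"
    moreover have "x + ((1 - t) *\<^sub>R a + t *\<^sub>R b) *\<^sub>R (u - x)
        = (1 - t) *\<^sub>R (x + a *\<^sub>R (u - x)) + t *\<^sub>R (x + b *\<^sub>R (u - x))"
      by (simp add: algebra_simps)
    ultimately show "?p ((1 - t) *\<^sub>R a + t *\<^sub>R b) \<le> (1 - t) * ?p a + t * ?p b"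
      using convex_onD[OF assms(1), of t] by (simp del: scaleR_left_diff_distrib)
  qed simp
  moreover have "(?p has_real_derivative g x \<bullet> (u - x)) (at 0)"
    using gderiv_along_line[OF assms(2), of x "u - x" 0] by simp
  ultimately have "?p 1 - ?p 0 \<ge> g x \<bullet> (u - x) * (1 - 0)"
    by (intro convex_on_imp_above_tangent[where A = UNIV]) auto
  then show ?thesis by simp
qed

lemma lipschitz_gradient_majorant:
  assumes "\<And>x. GDERIV f x :> g x" and "L-lipschitz_on UNIV g"
  shows "f u \<le> f x + g x \<bullet> (u - x) + L / 2 * (norm (u - x))\<^sup>2"
proof -
  define v where "v = u - x"
  let ?p = "\<lambda>t. f (x + t *\<^sub>R v) - t * (g x \<bullet> v) - L / 2 * t\<^sup>2 * (norm v)\<^sup>2"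
  let ?p' = "\<lambda>t. g (x + t *\<^sub>R v) \<bullet> v - g x \<bullet> v - L * t * (norm v)\<^sup>2"
  have deriv: "(?p has_real_derivative ?p' t) (at t)" for t
    by (auto intro!: derivative_eq_intros gderiv_along_line[OF assms(1)])
  have nonpos: "?p' t \<le> 0" if "0 \<le> t" for t
  proof -
    have "(g (x + t *\<^sub>R v) - g x) \<bullet> v \<le> norm (g (x + t *\<^sub>R v) - g x) * norm v"
      by (rule norm_cauchy_schwarz)
    also have "\<dots> \<le> (L * norm (t *\<^sub>R v)) * norm v"
      using lipschitz_onD[OF assms(2), of "x + t *\<^sub>R v" x]
      by (intro mult_right_mono) (auto simp: dist_norm)
    finally show ?thesis
      using that by (simp add: inner_diff_left power2_eq_square mult_ac)
  qed
  have "?p 0 \<ge> ?p 1"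
    using deriv nonpos by (intro DERIV_nonpos_imp_nonincreasing[of 0 1 ?p]) (simp, blast)
  then show ?thesis by (simp add: v_def)
qed

section \<open>Nesterov smoothing of a support function\<close>

lemma compact_SUP_attained:
  fixes \<psi> :: "'a::topological_space \<Rightarrow> real"
  assumes "compact Q" "Q \<noteq> {}" "continuous_on Q \<psi>"
  obtains w where "w \<in> Q" "(SUP v\<in>Q. \<psi> v) = \<psi> w" "\<And>v. v \<in> Q \<Longrightarrow> \<psi> v \<le> \<psi> w"
proof -
  obtain w where w: "w \<in> Q" "\<forall>v\<in>Q. \<psi> v \<le> \<psi> w"
    using continuous_attains_sup[OF assms] by blast
  then have "(SUP v\<in>Q. \<psi> v) = \<psi> w"
    by (intro cSup_eq_maximum) auto
  with w that show thesis by blast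
qed

lemma norm_matrix_vector_le_spectral_norm:
  fixes A :: "real^'n^'m"
  shows "norm (A *v x) \<le> spectral_norm A * norm x"
  unfolding spectral_norm_eq_onorm by (rule onorm) (rule matrix_vector_mul_bounded_linear)

lemma spectral_norm_nonneg: "0 \<le> spectral_norm (A :: real^'n^'m)"
  by (simp add: spectral_norm_eq_onorm onorm_pos_le matrix_vector_mul_bounded_linear)

lemma spectral_norm_pos:
  fixes A :: "real^'n^'m"
  assumes "A \<noteq> 0"
  shows "spectral_norm A > 0"
proof -
  have "\<exists>x. A *v x \<noteq> 0"
    using assms by (metis matrix_eq matrix_vector_mult_0)
  then show ?thesis
    by (simp add: spectral_norm_eq_onorm onorm_pos_lt matrix_vector_mul_bounded_linear)
qed

lemma inner_transpose_matrix_vector: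
  fixes A :: "real^'n^'m"
  shows "(transpose A *v v) \<bullet> x = v \<bullet> (A *v x)"
  by (metis dot_lmul_matrix transpose_matrix_vector)

lemma norm_transpose_le_spectral_norm:
  fixes A :: "real^'n^'m"
  shows "norm (transpose A *v v) \<le> spectral_norm A * norm v"
proof (cases "transpose A *v v = 0")
  case False
  have "(norm (transpose A *v v))\<^sup>2 = v \<bullet> (A *v (transpose A *v v))"
    unfolding power2_norm_eq_inner inner_transpose_matrix_vector ..
  also have "\<dots> \<le> norm v * norm (A *v (transpose A *v v))"
    by (rule norm_cauchy_schwarz)
  also have "\<dots> \<le> norm v * (spectral_norm A * norm (transpose A *v v))"
    by (intro mult_left_mono norm_matrix_vector_le_spectral_norm) simp
  finally show ?thesis
    using False by (simp add: power2_eq_square mult_ac)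
next
  case True
  then show ?thesis using spectral_norm_nonneg[of A] by simp
qed

lemma cont_differentiable_on_imp_continuous_on:
  "cont_differentiable_on d Q \<Longrightarrow> continuous_on Q d"
  by (auto simp: cont_differentiable_on_def continuous_on_eq_continuous_within
      intro: has_derivative_continuous)

locale smoothing =
  fixes A :: "real^'n^'m" and Q :: "(real^'m) set" and d :: "real^'m \<Rightarrow> real" and c \<mu> :: real
  assumes Q_nonempty: "Q \<noteq> {}" and Q_compact: "compact Q"
    and d_continuous: "continuous_on Q d" and d_strongly_convex: "strongly_convex_on Q c d"
    and c_pos: "c > 0" and \<mu>_pos: "\<mu> > 0"
begin

definition smoothed :: "real^'n \<Rightarrow> real" where
  "smoothed x = v_smooth A Q d \<mu> x \<bullet> (A *v x) - \<mu> * d (v_smooth A Q d \<mu> x)"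

lemma v_smooth_in: "v_smooth A Q d \<mu> x \<in> Q"
  and v_smooth_max: "v \<in> Q \<Longrightarrow> v \<bullet> (A *v x) - \<mu> * d v \<le> smoothed x"
proof -
  have cont: "continuous_on Q (\<lambda>v. v \<bullet> (A *v x) - \<mu> * d v)"
    by (intro continuous_intros d_continuous)
  obtain w where "w \<in> Q" "\<And>v. v \<in> Q \<Longrightarrow> v \<bullet> (A *v x) - \<mu> * d v \<le> w \<bullet> (A *v x) - \<mu> * d w"
    by (rule compact_SUP_attained[OF Q_compact Q_nonempty cont]) blast
  then have "is_arg_max (\<lambda>v. v \<bullet> (A *v x) - \<mu> * d v) (\<lambda>v. v \<in> Q) w"
    by (simp add: is_arg_max_def not_less)
  then have "is_arg_max (\<lambda>v. v \<bullet> (A *v x) - \<mu> * d v) (\<lambda>v. v \<in> Q) (v_smooth A Q d \<mu> x)"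
    unfolding v_smooth_def arg_max_on_def arg_max_def by (rule someI)
  then show "v_smooth A Q d \<mu> x \<in> Q"
    and "v \<in> Q \<Longrightarrow> v \<bullet> (A *v x) - \<mu> * d v \<le> smoothed x"
    by (auto simp: is_arg_max_def smoothed_def not_less)
qed

text \<open>
  The objective \<open>v \<bullet> A x - \<mu> d v\<close> is strongly concave with parameter \<open>\<mu> c\<close>. Along the segment from
  the maximizer to \<open>v\<close> it cannot exceed the maximum, so the strong concavity gain
  \<open>t (1 - t) \<mu> c / 2\<close> times the squared distance is paid for by the gap at \<open>v\<close>; divide by \<open>t\<close> and let
  \<open>t\<close> tend to \<open>0\<close>. This gap is the source of all smoothness of the smoothed function, and it also
  makes the maximizer unique.
\<close>

lemma v_smooth_quadratic_growth:
  assumes "v \<in> Q"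
  shows "v \<bullet> (A *v x) - \<mu> * d v + \<mu> * c / 2 * (norm (v_smooth A Q d \<mu> x - v))\<^sup>2 \<le> smoothed x"
proof -
  define w where "w = v_smooth A Q d \<mu> x"
  define K where "K = \<mu> * c / 2 * (norm (w - v))\<^sup>2"
  define gap where "gap = smoothed x - (v \<bullet> (A *v x) - \<mu> * d v)"
  have chord: "K * (1 - t) \<le> gap" if t: "0 < t" "t < 1" for t
  proof -
    let ?m = "(1 - t) *\<^sub>R w + t *\<^sub>R v"
    have "w \<in> Q" by (simp add: w_def v_smooth_in)
    have "?m \<in> Q"
      using d_strongly_convex \<open>w \<in> Q\<close> assms t
      by (simp add: strongly_convex_on_def convexD_alt)
    have "d ?m \<le> (1 - t) * d w + t * d v - c / 2 * t * (1 - t) * (norm (w - v))\<^sup>2"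
      using d_strongly_convex \<open>w \<in> Q\<close> assms t by (simp add: strongly_convex_on_def)
    from mult_left_mono[OF this, of \<mu>]
    have "\<mu> * d ?m \<le> (1 - t) * (\<mu> * d w) + t * (\<mu> * d v) - t * (K * (1 - t))"
      using \<mu>_pos by (simp add: K_def algebra_simps)
    moreover have "?m \<bullet> (A *v x) = (1 - t) * (w \<bullet> (A *v x)) + t * (v \<bullet> (A *v x))"
      by (simp add: inner_add_left)
    moreover have "?m \<bullet> (A *v x) - \<mu> * d ?m \<le> smoothed x"
      using \<open>?m \<in> Q\<close> by (rule v_smooth_max)
    ultimately have "t * (K * (1 - t)) \<le> t * gap"
      by (simp add: gap_def smoothed_def w_def[symmetric] algebra_simps)
    then show ?thesis
      using t(1) by (rule mult_left_le_imp_le)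
  qed
  have "((\<lambda>t. K * (1 - t)) \<longlongrightarrow> K * (1 - 0)) (at_right 0)"
    by (intro tendsto_intros)
  moreover have "eventually (\<lambda>t. K * (1 - t) \<le> gap) (at_right 0)"
    using eventually_at_right_real[OF zero_less_one] by (rule eventually_mono) (auto intro: chord)
  ultimately have "K * (1 - 0) \<le> gap"
    by (rule tendsto_upperbound) simp
  then show ?thesis by (simp add: K_def gap_def w_def)
qed

lemma smoothed_minorant:
  "smoothed x + (transpose A *v v_smooth A Q d \<mu> x) \<bullet> (u - x) \<le> smoothed u"
proof -
  have "(transpose A *v v_smooth A Q d \<mu> x) \<bullet> (u - x)
      = v_smooth A Q d \<mu> x \<bullet> (A *v u) - v_smooth A Q d \<mu> x \<bullet> (A *v x)"
    unfolding inner_transpose_matrix_vector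
    by (simp only: matrix_vector_mult_diff_distrib inner_diff_right)
  then show ?thesis
    using v_smooth_max[OF v_smooth_in, of x u] smoothed_def[of x] by linarith
qed

text \<open>
  The maximizer \<open>v'\<close> at \<open>u\<close> competes at \<open>x\<close>, where it loses the quadratic growth gap. What it can gain
  in exchange is \<open>(v' - v) \<bullet> A (u - x)\<close>, linear in the distance of the maximizers; completing the
  square leaves a quadratic in \<open>u - x\<close>.
\<close>

lemma smoothed_majorant:
  "smoothed u \<le> smoothed x + (transpose A *v v_smooth A Q d \<mu> x) \<bullet> (u - x)
     + (spectral_norm A)\<^sup>2 / (2 * c * \<mu>) * (norm (u - x))\<^sup>2"
proof -
  define v where "v = v_smooth A Q d \<mu> x"
  define v' where "v' = v_smooth A Q d \<mu> u"
  define r where "r = norm (v - v')"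
  define s where "s = spectral_norm A * norm (u - x)"
  have "v' \<bullet> (A *v x) - \<mu> * d v' + \<mu> * c / 2 * r\<^sup>2 \<le> smoothed x"
    unfolding r_def v_def by (rule v_smooth_quadratic_growth) (simp add: v'_def v_smooth_in)
  moreover have "(v' - v) \<bullet> (A *v (u - x)) \<le> r * s"
  proof -
    have "(v' - v) \<bullet> (A *v (u - x)) \<le> norm (v' - v) * norm (A *v (u - x))"
      by (rule norm_cauchy_schwarz)
    also have "\<dots> \<le> r * s"
      unfolding r_def s_def norm_minus_commute[of v]
      by (intro mult_left_mono norm_matrix_vector_le_spectral_norm) simp
    finally show ?thesis .
  qed
  moreover have "smoothed u = v' \<bullet> (A *v x) - \<mu> * d v' + v \<bullet> (A *v (u - x))
      + (v' - v) \<bullet> (A *v (u - x))"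
    by (simp add: smoothed_def v'_def matrix_vector_mult_diff_distrib inner_diff_right inner_diff_left)
  moreover have "r * s \<le> \<mu> * c / 2 * r\<^sup>2 + s\<^sup>2 / (2 * c * \<mu>)"
  proof -
    have "0 \<le> (\<mu> * c * r - s)\<^sup>2 / (2 * c * \<mu>)"
      using c_pos \<mu>_pos by simp
    also have "\<dots> = \<mu> * c / 2 * r\<^sup>2 + s\<^sup>2 / (2 * c * \<mu>) - r * s"
      using c_pos \<mu>_pos by (simp add: field_simps power2_eq_square)
    finally show ?thesis by simp
  qed
  ultimately show ?thesis
    unfolding inner_transpose_matrix_vector v_def[symmetric] by (simp add: s_def power_mult_distrib)
qed

text \<open>
  The minorant and the majorant share their affine part and differ by a quadratic, which leaves only
  this gradient.
\<close>

lemma smoothed_gderiv: "GDERIV smoothed x :> transpose A *v v_smooth A Q d \<mu> x"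
  unfolding gderiv_def has_derivative_at
proof (intro conjI)
  let ?g = "transpose A *v v_smooth A Q d \<mu> x" and ?C = "(spectral_norm A)\<^sup>2 / (2 * c * \<mu>)"
  show "bounded_linear (\<lambda>h. h \<bullet> ?g)" by (rule bounded_linear_inner_left)
  have le: "norm (norm (smoothed (x + h) - smoothed x - h \<bullet> ?g) / norm h) \<le> ?C * norm h" for h
  proof (cases "h = 0")
    case False
    have "\<bar>smoothed (x + h) - smoothed x - h \<bullet> ?g\<bar> \<le> ?C * (norm h)\<^sup>2"
      using smoothed_minorant[of x "x + h"] smoothed_majorant[of "x + h" x]
      by (simp add: inner_commute)
    then have "\<bar>smoothed (x + h) - smoothed x - h \<bullet> ?g\<bar> \<le> (?C * norm h) * norm h"
      by (simp add: power2_eq_square)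
    with False show ?thesis
      by (simp only: real_norm_def abs_divide abs_abs abs_norm_cancel pos_divide_le_eq
          zero_less_norm_iff not_False_eq_True simp_thms)
  qed simp
  have "((\<lambda>h::real^'n. ?C * norm h) \<longlongrightarrow> ?C * norm (0::real^'n)) (at 0)"
    by (intro tendsto_mult tendsto_const tendsto_norm tendsto_ident_at)
  then have "((\<lambda>h::real^'n. ?C * norm h) \<longlongrightarrow> 0) (at 0)" by simp
  then show "((\<lambda>h. norm (smoothed (x + h) - smoothed x - h \<bullet> ?g) / norm h) \<longlongrightarrow> 0) (at 0)"
    by (rule Lim_null_comparison[rotated]) (use le in \<open>auto intro: always_eventually\<close>)
qed

lemma smoothed_convex: "convex_on UNIV smoothed"
proof (rule convex_onI)
  fix t :: real and x y :: "real^'n"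
  assume t: "0 < t" "t < 1"
  define w where "w = (1 - t) *\<^sub>R x + t *\<^sub>R y"
  define v where "v = v_smooth A Q d \<mu> w"
  have "A *v w = (1 - t) *\<^sub>R (A *v x) + t *\<^sub>R (A *v y)"
    by (simp add: w_def matrix_vector_right_distrib matrix_vector_mult_scaleR)
  then have "smoothed w = (1 - t) * (v \<bullet> (A *v x) - \<mu> * d v) + t * (v \<bullet> (A *v y) - \<mu> * d v)"
    by (simp add: smoothed_def v_def[symmetric] inner_add_right ring_distribs)
  also have "\<dots> \<le> (1 - t) * smoothed x + t * smoothed y"
    using t v_smooth_max[OF v_smooth_in] unfolding v_def
    by (intro add_mono mult_left_mono) auto
  finally show "smoothed ((1 - t) *\<^sub>R x + t *\<^sub>R y) \<le> (1 - t) * smoothed x + t * smoothed y"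
    by (simp add: w_def)
qed simp

text \<open>
  Adding the growth inequalities of the two maximizers, each tested with the other, gives
  \<open>\<mu> c (norm (v - v'))\<^sup>2 \<le> (v - v') \<bullet> A (x - u)\<close>.
\<close>

lemma smoothed_gradient_lipschitz:
  "((spectral_norm A)\<^sup>2 / (c * \<mu>))-lipschitz_on UNIV (\<lambda>x. transpose A *v v_smooth A Q d \<mu> x)"
proof (rule lipschitz_onI)
  show "0 \<le> (spectral_norm A)\<^sup>2 / (c * \<mu>)"
    using c_pos \<mu>_pos by simp
next
  fix x u :: "real^'n"
  define v where "v = v_smooth A Q d \<mu> x"
  define v' where "v' = v_smooth A Q d \<mu> u"
  define r where "r = norm (v - v')"
  define s where "s = spectral_norm A * norm (x - u)"
  have "v' \<bullet> (A *v x) - \<mu> * d v' + \<mu> * c / 2 * r\<^sup>2 \<le> smoothed x"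
    unfolding r_def v_def by (rule v_smooth_quadratic_growth) (simp add: v'_def v_smooth_in)
  moreover have "v \<bullet> (A *v u) - \<mu> * d v + \<mu> * c / 2 * r\<^sup>2 \<le> smoothed u"
    unfolding r_def v'_def norm_minus_commute[of v]
    by (rule v_smooth_quadratic_growth) (simp add: v_def v_smooth_in)
  ultimately have "\<mu> * c * r\<^sup>2 \<le> (v - v') \<bullet> (A *v (x - u))"
    by (simp add: smoothed_def v_def[symmetric] v'_def[symmetric]
        matrix_vector_mult_diff_distrib inner_diff_right inner_diff_left)
  also have "\<dots> \<le> r * norm (A *v (x - u))"
    unfolding r_def by (rule norm_cauchy_schwarz)
  also have "\<dots> \<le> r * s"
    unfolding s_def by (intro mult_left_mono norm_matrix_vector_le_spectral_norm) (simp add: r_def)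
  finally have "r * (\<mu> * c * r) \<le> r * s" by (simp add: power2_eq_square mult_ac)
  moreover have "0 \<le> s"
    unfolding s_def using norm_ge_zero norm_matrix_vector_le_spectral_norm by (rule order_trans)
  ultimately have "\<mu> * c * r \<le> s"
    by (cases "r = 0") (auto simp: r_def)
  then have r: "r \<le> s / (c * \<mu>)"
    using c_pos \<mu>_pos by (simp add: field_simps)
  have "norm (transpose A *v v - transpose A *v v') \<le> spectral_norm A * r"
    unfolding r_def matrix_vector_mult_diff_distrib[symmetric] by (rule norm_transpose_le_spectral_norm)
  also have "\<dots> \<le> spectral_norm A * (s / (c * \<mu>))"
    using r spectral_norm_nonneg by (rule mult_left_mono)
  finally show "dist (transpose A *v v_smooth A Q d \<mu> x) (transpose A *v v_smooth A Q d \<mu> u)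
      \<le> (spectral_norm A)\<^sup>2 / (c * \<mu>) * dist x u"
    by (simp add: dist_norm v_def v'_def s_def power2_eq_square)
qed

lemma smoothed_le_support:
  assumes "\<And>v. v \<in> Q \<Longrightarrow> 0 \<le> d v"
  shows "smoothed x \<le> (SUP v\<in>Q. v \<bullet> (A *v x))"
proof -
  have "continuous_on Q (\<lambda>v. v \<bullet> (A *v x))" by (intro continuous_intros)
  then obtain w where "(SUP v\<in>Q. v \<bullet> (A *v x)) = w \<bullet> (A *v x)"
    "\<And>v. v \<in> Q \<Longrightarrow> v \<bullet> (A *v x) \<le> w \<bullet> (A *v x)"
    using compact_SUP_attained[OF Q_compact Q_nonempty] by blast
  moreover have "0 \<le> \<mu> * d (v_smooth A Q d \<mu> x)"
    using assms v_smooth_in \<mu>_pos by simp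
  ultimately show ?thesis
    using v_smooth_in[of x] by (force simp: smoothed_def)
qed

lemma support_le_smoothed:
  "(SUP v\<in>Q. v \<bullet> (A *v x)) \<le> smoothed x + \<mu> * (SUP v\<in>Q. d v)"
proof -
  have "continuous_on Q (\<lambda>v. v \<bullet> (A *v x))" by (intro continuous_intros)
  then obtain w where w: "w \<in> Q" "(SUP v\<in>Q. v \<bullet> (A *v x)) = w \<bullet> (A *v x)"
    using compact_SUP_attained[OF Q_compact Q_nonempty] by blast
  have "d w \<le> (SUP v\<in>Q. d v)"
    using compact_SUP_attained[OF Q_compact Q_nonempty d_continuous] w(1) by metis
  then have "\<mu> * d w \<le> \<mu> * (SUP v\<in>Q. d v)"
    using \<mu>_pos by simp
  then show ?thesis using v_smooth_max[OF w(1), of x] w(2) by linarith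
qed

end

text \<open>
  A maximizer at one point competes at every other point, so the function inherits the Lipschitz
  constant of \<open>x \<mapsto> v \<bullet> A x\<close>, which is bounded uniformly over the bounded set \<open>Q\<close>. Continuity is
  what makes the objective at a random point measurable.
\<close>

lemma support_function_continuous:
  fixes A :: "real^'n^'m"
  assumes "compact Q" "Q \<noteq> {}" and h: "\<And>x. h x = (SUP v\<in>Q. v \<bullet> (A *v x))"
  shows "continuous_on UNIV h"
proof -
  obtain R where R: "R > 0" "\<And>v. v \<in> Q \<Longrightarrow> norm v \<le> R"
    using compact_imp_bounded[OF assms(1)] by (auto simp: bounded_pos)
  have half: "h x - h u \<le> R * spectral_norm A * norm (x - u)" for x u
  proof -
    have cont: "continuous_on Q (\<lambda>v. v \<bullet> a)" for a
      by (intro continuous_intros)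
    obtain w where w: "w \<in> Q" "h x = w \<bullet> (A *v x)"
      using compact_SUP_attained[OF assms(1,2) cont] h by metis
    have "w \<bullet> (A *v u) \<le> h u"
      using compact_SUP_attained[OF assms(1,2) cont[of "A *v u"]] h w(1) by metis
    then have "h x - h u \<le> w \<bullet> (A *v (x - u))"
      by (simp add: w matrix_vector_mult_diff_distrib inner_diff_right)
    also have "\<dots> \<le> norm w * norm (A *v (x - u))" by (rule norm_cauchy_schwarz)
    also have "\<dots> \<le> R * (spectral_norm A * norm (x - u))"
      using R w(1) by (intro mult_mono norm_matrix_vector_le_spectral_norm) auto
    finally show ?thesis by simp
  qed
  have "(R * spectral_norm A)-lipschitz_on UNIV h"
  proof (rule lipschitz_onI)
    fix x u
    show "dist (h x) (h u) \<le> R * spectral_norm A * dist x u"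
      using half[of x u] half[of u x] by (simp add: dist_norm norm_minus_commute abs_le_iff)
  qed (use mult_nonneg_nonneg[OF less_imp_le[OF R(1)] spectral_norm_nonneg] in blast)
  then show ?thesis by (rule lipschitz_on_continuous_on)
qed

section \<open>One accelerated step\<close>

text \<open>
  The weight of the objective gap of \<open>x\<^sub>t\<close> in the potential. It agrees with the usual
  \<open>(t + 1)\<^sup>2 / 4\<close> to leading order, vanishes at \<open>t = 0\<close> (so the gap of the starting point does not
  enter the final bound), and \<open>weight (N + 1) \<ge> (N + 2)\<^sup>2 / 4\<close>.
\<close>

definition weight :: "nat \<Rightarrow> real" where
  "weight t = real t * (real t + 3) / 4"

text \<open>
  The relative weight of \<open>(norm (z\<^sub>t - x\<^sub>t))\<^sup>2\<close> in the potential. It pays for using \<open>x\<^sub>t\<close> as a second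
  comparison point in step \<open>t\<close>.
\<close>

definition inertia :: "nat \<Rightarrow> real" where
  "inertia t = real t / (real t + 2)\<^sup>2"

definition query :: "nat \<Rightarrow> 'a::real_vector \<times> 'a \<Rightarrow> 'a" where
  "query t = (\<lambda>(x, z). (1 - \<theta>_step t) *\<^sub>R x + \<theta>_step t *\<^sub>R z)"

definition update :: "real \<Rightarrow> nat \<Rightarrow> 'a::real_vector \<times> 'a \<Rightarrow> 'a \<Rightarrow> 'a \<times> 'a" where
  "update B t = (\<lambda>(x, z) w. let z' = z - (1 / (\<theta>_step t * B)) *\<^sub>R w
     in ((1 - \<theta>_step t) *\<^sub>R x + \<theta>_step t *\<^sub>R z', z'))"

lemma weight_nonneg: "0 \<le> weight t"
  by (simp add: weight_def)

lemma norm_add_sq: "(norm (a + b))\<^sup>2 = (norm a)\<^sup>2 + 2 * (b \<bullet> a) + (norm (b::'a::real_inner))\<^sup>2"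
  by (simp add: power2_norm_eq_inner inner_commute algebra_simps)

locale smooth_convex =
  fixes \<Phi> :: "'a::euclidean_space \<Rightarrow> real" and g :: "'a \<Rightarrow> 'a" and L :: real
  assumes convex: "convex_on UNIV \<Phi>" and gradient: "\<And>x. GDERIV \<Phi> x :> g x"
    and lipschitz: "L-lipschitz_on UNIV g"
begin

lemmas minorant = convex_gradient_minorant[OF convex gradient]
lemmas majorant = lipschitz_gradient_majorant[OF gradient lipschitz]

text \<open>
  One step, compared with two points at once: weight \<open>a\<close> on an arbitrary \<open>u\<close> and weight \<open>\<alpha>\<close> on the
  current \<open>x\<close>. The majorant at \<open>y\<close> bounds \<open>\<Phi> x'\<close>, the minorants at \<open>y\<close> bound \<open>\<Phi> u\<close> and \<open>\<Phi> x\<close> from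
  below, and what remains is \<open>g y \<bullet> (a (z' - u) + \<kappa> (z' - x))\<close>, which the three-point identity turns
  into differences of squared distances. The classical choice is \<open>\<kappa> = 0\<close>; a positive \<open>\<kappa>\<close> is what
  permits weights \<open>\<alpha>\<close> that telescope exactly while \<open>a \<theta>\<close> stays constant.

  The vector \<open>\<delta>\<close> is the error of the gradient estimate. The left-hand side measures distances from
  \<open>zb\<close>, the point that the exact gradient would have produced. The noise therefore enters only
  through the curvature term and a linear term, which has mean zero when \<open>\<delta>\<close> has.
\<close>

lemma accelerated_step:
  fixes x z u \<delta> :: 'a and \<theta> B \<alpha> a \<kappa> :: real
  defines "y \<equiv> (1 - \<theta>) *\<^sub>R x + \<theta> *\<^sub>R z"
  defines "zb \<equiv> z - (1 / (\<theta> * B)) *\<^sub>R g y"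
  defines "z' \<equiv> zb + (1 / (\<theta> * B)) *\<^sub>R \<delta>"
  defines "x' \<equiv> (1 - \<theta>) *\<^sub>R x + \<theta> *\<^sub>R z'"
  assumes "0 < \<theta>" "0 < B" "L \<le> B" "0 \<le> \<alpha>" "0 \<le> a" "0 \<le> \<kappa>"
    and u_weight: "(\<alpha> + a) * \<theta> = a + \<kappa>"
  shows "(\<alpha> + a) * (\<Phi> x' - \<Phi> u) + a * \<theta> * B / 2 * (norm (zb - u))\<^sup>2
      + \<kappa> * \<theta> * B / 2 * (norm (zb - x))\<^sup>2
    \<le> \<alpha> * (\<Phi> x - \<Phi> u) + a * \<theta> * B / 2 * (norm (z - u))\<^sup>2
      + \<kappa> * \<theta> * B / 2 * (norm (z - x))\<^sup>2
      + (\<alpha> + a) * L / (2 * B\<^sup>2) * (norm \<delta>)\<^sup>2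
      + \<delta> \<bullet> (((\<alpha> + a) / B * (1 - L / B)) *\<^sub>R g y)"
proof -
  define \<beta> where "\<beta> = \<theta> * B"
  have \<beta>: "\<beta> > 0" using assms by (simp add: \<beta>_def)
  define G where "G = (norm (g y))\<^sup>2"
  have gy: "g y = \<beta> *\<^sub>R (z - zb)" using assms(5,6) by (simp add: zb_def \<beta>_def)
  have "x' - y = (\<theta> / \<beta>) *\<^sub>R (\<delta> - g y)"
    by (simp add: x'_def y_def z'_def zb_def \<beta>_def algebra_simps)
  moreover have "(norm (\<delta> - g y))\<^sup>2 = (norm \<delta>)\<^sup>2 - 2 * (\<delta> \<bullet> g y) + G"
    by (simp add: power2_norm_eq_inner G_def inner_commute algebra_simps)
  ultimately have dist: "(norm (x' - y))\<^sup>2 = ((norm \<delta>)\<^sup>2 - 2 * (\<delta> \<bullet> g y) + G) / B\<^sup>2"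
    using assms(5,6) by (simp add: power_mult_distrib \<beta>_def power_divide)
  \<comment> \<open>The condition \<open>u_weight\<close> is used here: it makes the coefficient of \<open>z'\<close> equal \<open>a + \<kappa>\<close>.\<close>
  have comb: "(\<alpha> + a) *\<^sub>R (x' - y) = \<alpha> *\<^sub>R (x - y) + a *\<^sub>R (u - y) + a *\<^sub>R (z' - u) + \<kappa> *\<^sub>R (z' - x)"
  proof -
    have "(\<alpha> + a) *\<^sub>R x' = (\<alpha> + a - (a + \<kappa>)) *\<^sub>R x + (a + \<kappa>) *\<^sub>R z'"
      unfolding u_weight[symmetric] x'_def by (simp add: algebra_simps)
    then show ?thesis by (simp add: algebra_simps)
  qed
  have "(\<alpha> + a) * \<Phi> x' \<le> (\<alpha> + a) * (\<Phi> y + g y \<bullet> (x' - y) + L / 2 * (norm (x' - y))\<^sup>2)"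
    using majorant[of x' y] assms by (intro mult_left_mono) auto
  moreover have "\<alpha> * (\<Phi> y + g y \<bullet> (x - y)) \<le> \<alpha> * \<Phi> x" "a * (\<Phi> y + g y \<bullet> (u - y)) \<le> a * \<Phi> u"
    using minorant assms by (auto intro!: mult_left_mono)
  moreover have "(\<alpha> + a) * (g y \<bullet> (x' - y)) = \<alpha> * (g y \<bullet> (x - y)) + a * (g y \<bullet> (u - y))
      + a * (g y \<bullet> (z' - u)) + \<kappa> * (g y \<bullet> (z' - x))"
    using arg_cong[OF comb, of "inner (g y)"] by (simp only: inner_add_right inner_scaleR_right)
  ultimately have descent: "(\<alpha> + a) * (\<Phi> x' - \<Phi> u) - \<alpha> * (\<Phi> x - \<Phi> u)
      \<le> a * (g y \<bullet> (z' - u)) + \<kappa> * (g y \<bullet> (z' - x)) + (\<alpha> + a) * (L / 2 * (norm (x' - y))\<^sup>2)"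
    by (simp add: ring_distribs)
  have three_point: "g y \<bullet> (z' - w) = \<beta> / 2 * ((norm (z - w))\<^sup>2 - (norm (zb - w))\<^sup>2) - G / (2 * \<beta>)
      + (\<delta> \<bullet> g y) / \<beta>" for w
  proof -
    have "g y \<bullet> (zb - w) = \<beta> / 2 * ((norm (z - w))\<^sup>2 - (norm (zb - w))\<^sup>2 - (norm (z - zb))\<^sup>2)"
      unfolding gy by (simp add: power2_norm_eq_inner inner_commute algebra_simps)
    moreover have "G / (2 * \<beta>) = \<beta> / 2 * (norm (z - zb))\<^sup>2"
      using \<beta> unfolding G_def gy by (simp add: power_mult_distrib power2_eq_square)
    moreover have "g y \<bullet> (z' - w) = g y \<bullet> (zb - w) + (\<delta> \<bullet> g y) / \<beta>"
      by (simp add: z'_def \<beta>_def inner_diff_right inner_add_right inner_commute)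
    ultimately show ?thesis by (simp add: right_diff_distrib)
  qed
  have "a * (g y \<bullet> (z' - u)) + \<kappa> * (g y \<bullet> (z' - x))
      = a * \<beta> / 2 * ((norm (z - u))\<^sup>2 - (norm (zb - u))\<^sup>2)
        + \<kappa> * \<beta> / 2 * ((norm (z - x))\<^sup>2 - (norm (zb - x))\<^sup>2)
        + (a + \<kappa>) / \<beta> * (\<delta> \<bullet> g y - G / 2)"
    unfolding three_point using \<beta> by (simp add: field_simps)
  also have "(a + \<kappa>) / \<beta> = (\<alpha> + a) / B"
    using assms(5,6) by (simp add: u_weight[symmetric] \<beta>_def)
  finally have inner: "a * (g y \<bullet> (z' - u)) + \<kappa> * (g y \<bullet> (z' - x))
      = a * \<beta> / 2 * ((norm (z - u))\<^sup>2 - (norm (zb - u))\<^sup>2)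
        + \<kappa> * \<beta> / 2 * ((norm (z - x))\<^sup>2 - (norm (zb - x))\<^sup>2)
        + (\<alpha> + a) / B * (\<delta> \<bullet> g y - G / 2)" .
  have "(\<alpha> + a) / B * (\<delta> \<bullet> g y - G / 2) + (\<alpha> + a) * (L / 2 * (norm (x' - y))\<^sup>2)
      = (\<alpha> + a) * L / (2 * B\<^sup>2) * (norm \<delta>)\<^sup>2 + ((\<alpha> + a) / B * (1 - L / B)) * (\<delta> \<bullet> g y)
        - (\<alpha> + a) / (2 * B) * (1 - L / B) * G"
    unfolding dist using assms(6) by (simp add: field_simps power2_eq_square)
  moreover have "0 \<le> (\<alpha> + a) / (2 * B) * (1 - L / B) * G"
    using assms by (simp add: G_def)
  ultimately show ?thesis
    using descent inner by (simp add: \<beta>_def algebra_simps)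
qed

text \<open>
  With \<open>\<theta>\<^sub>t = 2 / (t + 2)\<close>, \<open>a = 1 / \<theta>\<^sub>t\<close> and \<open>\<kappa> = t / (2 (t + 2))\<close> the coefficient \<open>a \<theta>\<^sub>t B\<close> of
  \<open>(norm (z - u))\<^sup>2\<close> does not depend on \<open>t\<close>, and \<open>weight t + a = weight (t + 1)\<close> holds exactly. Hence
  the following potential telescopes whatever the signs of \<open>\<Phi> x\<^sub>t - \<Phi> u\<close>.
\<close>

definition potential :: "real \<Rightarrow> 'a \<Rightarrow> nat \<Rightarrow> 'a \<times> 'a \<Rightarrow> real" where
  "potential B u t = (\<lambda>(x, z). weight t * (\<Phi> x - \<Phi> u) + B / 2 * (norm (z - u))\<^sup>2
     + B / 2 * inertia t * (norm (z - x))\<^sup>2)"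

text \<open>
  The vectors whose inner products with the gradient error \<open>\<delta>\<close> are the linear noise terms of a
  step: first without, then with the displacement of \<open>z\<close> from \<open>zb\<close> by the noise. Both are functions
  of the state before the sample is drawn.
\<close>

definition final_correlation :: "real \<Rightarrow> nat \<Rightarrow> 'a \<times> 'a \<Rightarrow> 'a" where
  "final_correlation B t p = (weight (Suc t) / B * (1 - L / B)) *\<^sub>R g (query t p)"

definition correlation :: "real \<Rightarrow> 'a \<Rightarrow> nat \<Rightarrow> 'a \<times> 'a \<Rightarrow> 'a" where
  "correlation B u t = (\<lambda>(x, z). let zb = z - (1 / (\<theta>_step t * B)) *\<^sub>R g (query t (x, z))
     in final_correlation B t (x, z) + (1 / \<theta>_step t) *\<^sub>R (zb - u)
        + (inertia t / \<theta>_step t) *\<^sub>R (zb - x))"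

text \<open>
  Two forms of the same step. The second one continues the potential: it replaces \<open>zb\<close> by the actual
  \<open>z' = zb + \<delta> / (\<theta> B)\<close>, which costs a further \<open>weight (t + 1) / (2 B)\<close> times \<open>(norm \<delta>)\<^sup>2\<close>. The first
  one is for the last step: the distance terms are dropped there, so this cost need not be paid.
  For very few iterations the difference decides whether the final constant is reached.
\<close>

lemma
  fixes p :: "'a \<times> 'a" and u w :: 'a and B :: real and t :: nat
  assumes B: "0 < B" "L \<le> B"
  defines "p' \<equiv> update B t p w"
  defines "\<delta> \<equiv> g (query t p) - w"
  shows final_potential_step: "weight (Suc t) * (\<Phi> (fst p') - \<Phi> u)
      \<le> potential B u t p + weight (Suc t) * L / (2 * B\<^sup>2) * (norm \<delta>)\<^sup>2
        + \<delta> \<bullet> final_correlation B t p"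
    and potential_step: "potential B u (Suc t) p'
      \<le> potential B u t p + weight (Suc t) * (B + L) / (2 * B\<^sup>2) * (norm \<delta>)\<^sup>2
        + \<delta> \<bullet> correlation B u t p"
proof -
  obtain x z where p: "p = (x, z)" by force
  define \<theta> where "\<theta> = \<theta>_step t"
  define y where "y = (1 - \<theta>) *\<^sub>R x + \<theta> *\<^sub>R z"
  define zb where "zb = z - (1 / (\<theta> * B)) *\<^sub>R g y"
  define z' where "z' = zb + (1 / (\<theta> * B)) *\<^sub>R \<delta>"
  define x' where "x' = (1 - \<theta>) *\<^sub>R x + \<theta> *\<^sub>R z'"
  define a \<kappa> \<psi> where "a = (real t + 2) / 2" and "\<kappa> = real t / (2 * (real t + 2))" and "\<psi> = inertia t"
  have t2: "real t + 2 > 0" by simp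
  have \<theta>: "\<theta> = 2 / (real t + 2)" "0 < \<theta>" by (simp_all add: \<theta>_def \<theta>_step_def)
  have y: "query t p = y" by (simp add: query_def p y_def \<theta>_def)
  have "z' = z - (1 / (\<theta> * B)) *\<^sub>R w"
    by (simp add: z'_def zb_def \<delta>_def y scaleR_diff_right)
  then have p': "p' = (x', z')"
    by (simp add: p'_def update_def p Let_def x'_def \<theta>_def)
  have w1: "weight (Suc t) = weight t + a"
    by (simp add: weight_def a_def field_simps)
  have "r / (2 * s) * (2 / s) = r / s\<^sup>2" for r s :: real
    by (simp add: power2_eq_square)
  then have a\<theta>: "a * \<theta> = 1" "\<kappa> * \<theta> = \<psi>"
    using t2 by (simp_all only: a_def \<kappa>_def \<psi>_def inertia_def \<theta>(1)) simp
  have uw: "(weight t + a) * \<theta> = a + \<kappa>"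
    using t2 by (simp add: a_def \<kappa>_def weight_def \<theta>(1) field_simps)
  have nonneg: "0 \<le> a" "0 \<le> \<kappa>" by (simp_all add: a_def \<kappa>_def)
  have coeffs: "a * \<theta> * B / 2 = B / 2" "\<kappa> * \<theta> * B / 2 = B / 2 * \<psi>"
    using a\<theta> by simp_all
  have step: "weight (Suc t) * (\<Phi> x' - \<Phi> u) + B / 2 * (norm (zb - u))\<^sup>2
      + B / 2 * \<psi> * (norm (zb - x))\<^sup>2
    \<le> potential B u t p + weight (Suc t) * L / (2 * B\<^sup>2) * (norm \<delta>)\<^sup>2 + \<delta> \<bullet> final_correlation B t p"
    using accelerated_step[OF \<theta>(2) B weight_nonneg nonneg uw, of x z \<delta> u, unfolded coeffs]
    by (simp add: w1 final_correlation_def potential_def p y[unfolded p] \<psi>_def[symmetric]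
      x'_def[symmetric] z'_def[symmetric] zb_def[symmetric] y_def[symmetric])
  have \<psi>: "0 \<le> \<psi>" by (simp add: \<psi>_def inertia_def)
  have "0 \<le> B / 2 * (norm (zb - u))\<^sup>2" "0 \<le> B / 2 * \<psi> * (norm (zb - x))\<^sup>2"
    using B \<psi> by simp_all
  with step show "weight (Suc t) * (\<Phi> (fst p') - \<Phi> u)
      \<le> potential B u t p + weight (Suc t) * L / (2 * B\<^sup>2) * (norm \<delta>)\<^sup>2
        + \<delta> \<bullet> final_correlation B t p"
    by (simp add: p')
  have "(norm (z' - v))\<^sup>2 = (norm (zb - v))\<^sup>2 + 2 / (\<theta> * B) * (\<delta> \<bullet> (zb - v)) + (norm \<delta>)\<^sup>2 / (\<theta> * B)\<^sup>2" for v
  proof -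
    have "z' - v = (zb - v) + (1 / (\<theta> * B)) *\<^sub>R \<delta>" by (simp add: z'_def)
    then show ?thesis
      by (simp only: norm_add_sq) (simp add: power_mult_distrib power_divide)
  qed
  then have "B / 2 * (norm (z' - v))\<^sup>2
      = B / 2 * (norm (zb - v))\<^sup>2 + 1 / \<theta> * (\<delta> \<bullet> (zb - v)) + (norm \<delta>)\<^sup>2 / (2 * B * \<theta>\<^sup>2)" for v
    using B \<theta>(2) by (simp add: distrib_left power2_eq_square)
  from this[of u] arg_cong[OF this[of x], of "\<lambda>r. \<psi> * r"]
  have spread: "B / 2 * (norm (z' - u))\<^sup>2 + B / 2 * \<psi> * (norm (z' - x))\<^sup>2
      = B / 2 * (norm (zb - u))\<^sup>2 + B / 2 * \<psi> * (norm (zb - x))\<^sup>2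
        + \<delta> \<bullet> ((1 / \<theta>) *\<^sub>R (zb - u) + (\<psi> / \<theta>) *\<^sub>R (zb - x)) + (1 + \<psi>) / (2 * B * \<theta>\<^sup>2) * (norm \<delta>)\<^sup>2"
    by (simp add: inner_add_right add_divide_distrib algebra_simps)
  have "(1 + r / s\<^sup>2) / (2 / s)\<^sup>2 = (s\<^sup>2 + r) / 4" if "s > 0" for r s :: real
    using that by (simp add: field_simps)
  from this[OF t2, of "real t"] have "(1 + \<psi>) / \<theta>\<^sup>2 = weight (Suc t)"
    by (simp add: \<psi>_def inertia_def \<theta>(1) weight_def power2_eq_square algebra_simps)
  then have noise: "(1 + \<psi>) / (2 * B * \<theta>\<^sup>2) + weight (Suc t) * L / (2 * B\<^sup>2)
      = weight (Suc t) * (B + L) / (2 * B\<^sup>2)"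
    using B \<theta>(2) by (simp add: field_simps power2_eq_square)
  \<comment> \<open>Moving from \<open>x\<close> to \<open>x'\<close> contracts the distance to \<open>z'\<close> by \<open>t / (t + 2)\<close>, faster than the
    factor \<open>inertia\<close> can grow.\<close>
  have "z' - x' = (1 - \<theta>) *\<^sub>R (z' - x)"
    by (simp add: x'_def algebra_simps)
  then have "inertia (Suc t) * (norm (z' - x'))\<^sup>2 = inertia (Suc t) * (1 - \<theta>)\<^sup>2 * (norm (z' - x))\<^sup>2"
    by (simp add: power_mult_distrib)
  also have "\<dots> \<le> \<psi> * (norm (z' - x))\<^sup>2"
  proof (rule mult_right_mono)
    have "inertia (Suc t) * (1 - \<theta>)\<^sup>2 = ((real t + 1) * real t / (real t + 3)\<^sup>2) * \<psi>"
    proof -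
      have "1 - \<theta> = real t / (real t + 2)"
        using t2 by (simp add: \<theta>(1) field_simps)
      moreover have "inertia (Suc t) = (real t + 1) / (real t + 3)\<^sup>2"
        by (simp add: inertia_def add.commute)
      ultimately show ?thesis
        by (simp add: \<psi>_def inertia_def[of t] power_divide power2_eq_square)
    qed
    moreover have "(real t + 1) * real t \<le> (real t + 3)\<^sup>2"
      unfolding power2_eq_square by (intro mult_mono) auto
    then have "(real t + 1) * real t / (real t + 3)\<^sup>2 \<le> 1"
      by (simp add: divide_le_eq)
    ultimately show "inertia (Suc t) * (1 - \<theta>)\<^sup>2 \<le> \<psi>"
      using \<psi> by (metis mult_left_le_one_le mult_1 mult_right_mono)
  qed simp
  finally have "B / 2 * inertia (Suc t) * (norm (z' - x'))\<^sup>2 \<le> B / 2 * \<psi> * (norm (z' - x))\<^sup>2"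
    using B by (simp add: mult.assoc)
  moreover have "\<delta> \<bullet> correlation B u t p
      = \<delta> \<bullet> final_correlation B t p + \<delta> \<bullet> ((1 / \<theta>) *\<^sub>R (zb - u) + (\<psi> / \<theta>) *\<^sub>R (zb - x))"
    by (simp add: correlation_def p Let_def \<theta>_def[symmetric] \<psi>_def y[unfolded p] zb_def inner_add_right)
  ultimately show "potential B u (Suc t) p'
      \<le> potential B u t p + weight (Suc t) * (B + L) / (2 * B\<^sup>2) * (norm \<delta>)\<^sup>2
        + \<delta> \<bullet> correlation B u t p"
    using step spread unfolding p' potential_def noise[symmetric]
    by (simp add: distrib_right)
qed

end

section \<open>Square-integrable random vectors\<close>

lemma integrable_dominated:
  fixes k K :: "'w \<Rightarrow> real"
  assumes "integrable M K" "k \<in> borel_measurable M" "\<And>\<omega>. 0 \<le> k \<omega>" "\<And>\<omega>. k \<omega> \<le> K \<omega>"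
  shows "integrable M k"
  using assms(1,2)
proof (rule Bochner_Integration.integrable_bound)
  show "AE \<omega> in M. norm (k \<omega>) \<le> norm (K \<omega>)"
    using assms(3,4) by (intro AE_I2) (metis abs_of_nonneg order_trans real_norm_def)
qed

definition square_integrable :: "'w measure \<Rightarrow> ('w \<Rightarrow> 'a::euclidean_space) \<Rightarrow> bool" where
  "square_integrable M X \<longleftrightarrow> X \<in> borel_measurable M \<and> integrable M (\<lambda>\<omega>. (norm (X \<omega>))\<^sup>2)"

lemma square_integrable_add:
  fixes X Y :: "'w \<Rightarrow> 'a::euclidean_space"
  assumes "square_integrable M X" "square_integrable M Y"
  shows "square_integrable M (\<lambda>\<omega>. X \<omega> + Y \<omega>)"
proof -
  note [measurable] = assms[unfolded square_integrable_def, THEN conjunct1]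
  have "(norm (x + y))\<^sup>2 \<le> 2 * (norm x)\<^sup>2 + 2 * (norm y)\<^sup>2" for x y :: 'a
  proof -
    have "(norm (x + y))\<^sup>2 \<le> (norm x + norm y)\<^sup>2"
      by (intro power_mono norm_triangle_ineq) simp
    also have "\<dots> \<le> 2 * (norm x)\<^sup>2 + 2 * (norm y)\<^sup>2"
      using sum_squares_bound[of "norm x" "norm y"] by (simp add: power2_sum)
    finally show ?thesis .
  qed
  moreover have "integrable M (\<lambda>\<omega>. 2 * (norm (X \<omega>))\<^sup>2 + 2 * (norm (Y \<omega>))\<^sup>2)"
    using assms by (simp add: square_integrable_def)
  ultimately have "integrable M (\<lambda>\<omega>. (norm (X \<omega> + Y \<omega>))\<^sup>2)"
    by - (rule integrable_dominated[of M "\<lambda>\<omega>. 2 * (norm (X \<omega>))\<^sup>2 + 2 * (norm (Y \<omega>))\<^sup>2"], simp_all)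
  then show ?thesis by (simp add: square_integrable_def)
qed

lemma square_integrable_scaleR:
  "square_integrable M X \<Longrightarrow> square_integrable M (\<lambda>\<omega>. r *\<^sub>R X \<omega>)"
  by (auto simp: square_integrable_def power_mult_distrib)

lemma square_integrable_diff:
  "square_integrable M X \<Longrightarrow> square_integrable M Y \<Longrightarrow> square_integrable M (\<lambda>\<omega>. X \<omega> - Y \<omega>)"
  using square_integrable_add[of M X "\<lambda>\<omega>. (-1) *\<^sub>R Y \<omega>"] square_integrable_scaleR[of M Y "-1"] by simp

lemma (in finite_measure) square_integrable_const: "square_integrable M (\<lambda>\<omega>. a)"
  by (simp add: square_integrable_def)

lemma square_integrable_inner:
  assumes "square_integrable M X" "square_integrable M Y"
  shows "integrable M (\<lambda>\<omega>. X \<omega> \<bullet> Y \<omega>)"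
proof -
  have "(\<lambda>\<omega>. X \<omega> \<bullet> Y \<omega>)
      = (\<lambda>\<omega>. ((norm (X \<omega> + Y \<omega>))\<^sup>2 - (norm (X \<omega>))\<^sup>2 - (norm (Y \<omega>))\<^sup>2) / 2)"
    by (simp add: power2_norm_eq_inner inner_commute algebra_simps)
  then show ?thesis
    using assms square_integrable_add[OF assms] by (simp add: square_integrable_def)
qed

lemma (in finite_measure) square_integrable_lipschitz:
  assumes "square_integrable M X" "C-lipschitz_on UNIV f"
  shows "square_integrable M (\<lambda>\<omega>. f (X \<omega>))"
proof -
  have "continuous_on UNIV f" using assms(2) by (rule lipschitz_on_continuous_on)
  then have [measurable]: "f \<in> borel_measurable borel" by (rule borel_measurable_continuous_onI)
  note [measurable] = assms(1)[unfolded square_integrable_def, THEN conjunct1]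
  have "(norm (f x - f 0))\<^sup>2 \<le> C\<^sup>2 * (norm x)\<^sup>2" for x
  proof -
    have "norm (f x - f 0) \<le> C * norm x"
      using lipschitz_onD[OF assms(2), of x 0] by (simp add: dist_norm)
    then show ?thesis
      by (metis power_mono norm_ge_zero power_mult_distrib)
  qed
  moreover have "integrable M (\<lambda>\<omega>. C\<^sup>2 * (norm (X \<omega>))\<^sup>2)"
    using assms(1) by (simp add: square_integrable_def)
  ultimately have "integrable M (\<lambda>\<omega>. (norm (f (X \<omega>) - f 0))\<^sup>2)"
    by - (rule integrable_dominated[of M "\<lambda>\<omega>. C\<^sup>2 * (norm (X \<omega>))\<^sup>2"], simp_all)
  then have "square_integrable M (\<lambda>\<omega>. f (X \<omega>) - f 0)"
    by (simp add: square_integrable_def)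
  from square_integrable_add[OF this square_integrable_const[of "f 0"]] show ?thesis by simp
qed

section \<open>Sampling independently of the past\<close>

text \<open>
  Independence of the past \<open>X\<close> and the new sample \<open>Y\<close> is stated as a product form of the joint
  distribution, because \<open>X\<close> and \<open>Y\<close> take values in different types. By Fubini, a bound or an identity
  that holds in the mean over the sample for every fixed past holds in expectation.
\<close>

context prob_space
begin

context
  fixes X :: "'a \<Rightarrow> 'b" and Y :: "'a \<Rightarrow> 's" and S :: "'b measure" and P :: "'s measure"
    and k :: "'b \<times> 's \<Rightarrow> real"
  assumes first_measurable: "X \<in> measurable M S" and second_measurable: "Y \<in> measurable M P"
    and dist_Y: "distr M P Y = P"
    and joint_distribution: "distr M (S \<Otimes>\<^sub>M P) (\<lambda>\<omega>. (X \<omega>, Y \<omega>)) = distr M S X \<Otimes>\<^sub>M P"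
    and k_meas: "k \<in> borel_measurable (S \<Otimes>\<^sub>M P)"
begin

lemma pair_prob: "prob_space (distr M S X)" "prob_space P"
  using prob_space_distr[OF first_measurable] prob_space_distr[OF second_measurable] dist_Y by auto

lemma integral_independent_sample:
  assumes "integrable M (\<lambda>\<omega>. k (X \<omega>, Y \<omega>))"
  shows "(\<integral>\<omega>. k (X \<omega>, Y \<omega>) \<partial>M) = (\<integral>\<omega>. (\<integral>s. k (X \<omega>, s) \<partial>P) \<partial>M)"
proof -
  interpret D: prob_space "distr M S X" by (rule pair_prob)
  interpret P: prob_space P by (rule pair_prob)
  interpret DP: pair_sigma_finite "distr M S X" P ..
  note [measurable] = k_meas first_measurable second_measurable
  have "integrable (distr M S X \<Otimes>\<^sub>M P) k"
    using assms unfolding joint_distribution[symmetric] by (simp add: integrable_distr_eq)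
  then have "(\<integral>x. (\<integral>s. k (x, s) \<partial>P) \<partial>distr M S X) = integral\<^sup>L (distr M S X \<Otimes>\<^sub>M P) k"
    by (rule DP.integral_fst')
  then show ?thesis
    unfolding joint_distribution[symmetric] by (simp add: integral_distr)
qed

lemma integrable_independent_sample:
  assumes "\<And>x s. 0 \<le> k (x, s)" and "\<And>x. integrable P (\<lambda>s. k (x, s))"
    and "\<And>x. (\<integral>s. k (x, s) \<partial>P) \<le> C"
  shows "integrable M (\<lambda>\<omega>. k (X \<omega>, Y \<omega>))" and "(\<integral>\<omega>. k (X \<omega>, Y \<omega>) \<partial>M) \<le> C"
proof -
  interpret D: prob_space "distr M S X" by (rule pair_prob)
  interpret P: prob_space P by (rule pair_prob)
  interpret DP: pair_sigma_finite "distr M S X" P ..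
  note [measurable] = k_meas first_measurable second_measurable
  have "0 \<le> C"
    using assms(1) by (intro order_trans[OF _ assms(3)[of undefined]] Bochner_Integration.integral_nonneg)
  have "integrable (distr M S X) (\<lambda>x. \<integral>s. norm (k (x, s)) \<partial>P)"
    using assms(1,3) \<open>0 \<le> C\<close> by (intro D.integrable_const_bound[of _ C]) (auto simp: abs_le_iff)
  then have "integrable (distr M S X \<Otimes>\<^sub>M P) k"
    by (intro DP.Fubini_integrable) (use assms in auto)
  then show int: "integrable M (\<lambda>\<omega>. k (X \<omega>, Y \<omega>))"
    unfolding joint_distribution[symmetric] by (simp add: integrable_distr_eq)
  have "(\<integral>\<omega>. (\<integral>s. k (X \<omega>, s) \<partial>P) \<partial>M) \<le> (\<integral>\<omega>. C \<partial>M)"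
  proof (rule integral_mono)
    show "integrable M (\<lambda>\<omega>. \<integral>s. k (X \<omega>, s) \<partial>P)"
      using assms(1,3) \<open>0 \<le> C\<close> by (intro integrable_const_bound[of _ C]) (auto simp: abs_le_iff)
  qed (use assms(3) in auto)
  then show "(\<integral>\<omega>. k (X \<omega>, Y \<omega>) \<partial>M) \<le> C"
    by (simp add: integral_independent_sample[OF int] prob_space)
qed

end

end

section \<open>The accelerated stochastic gradient method\<close>

primrec trajectory ::
  "real \<Rightarrow> ('a::real_vector \<Rightarrow> 's \<Rightarrow> 'a) \<Rightarrow> 'a \<Rightarrow> (nat \<Rightarrow> 's) \<Rightarrow> nat \<Rightarrow> 'a \<times> 'a" where
  "trajectory B H x0 s 0 = (x0, x0)"
| "trajectory B H x0 s (Suc t) =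
     update B t (trajectory B H x0 s t) (H (query t (trajectory B H x0 s t)) (s t))"

lemma trajectory_cong:
  "(\<And>i. i < t \<Longrightarrow> s i = s' i) \<Longrightarrow> trajectory B H x0 s t = trajectory B H x0 s' t"
  by (induction t) auto

lemma query_measurable [measurable]:
  "query t \<in> borel_measurable (borel :: ('a::euclidean_space \<times> 'a) measure)"
  unfolding query_def case_prod_unfold
  by (intro borel_measurable_continuous_onI continuous_intros)

lemma update_measurable:
  fixes X :: "'b \<Rightarrow> 'a::euclidean_space \<times> 'a"
  assumes "X \<in> borel_measurable S" "W \<in> borel_measurable S"
  shows "(\<lambda>\<omega>. update B t (X \<omega>) (W \<omega>)) \<in> borel_measurable S"
proof -
  have "continuous_on UNIV (\<lambda>q. update B t (fst q) (snd q :: 'a))"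
    unfolding update_def case_prod_unfold Let_def by (intro continuous_intros)
  then show ?thesis
    by (rule borel_measurable_continuous_Pair[OF assms])
qed

text \<open>
  The state after \<open>t\<close> steps is a function of the first \<open>t\<close> samples only, and measurability is claimed
  on the product of exactly these coordinates. This form yields both the measurability of the random
  state and its independence of the sample drawn next.
\<close>

lemma trajectory_measurable:
  fixes H :: "'a::euclidean_space \<Rightarrow> 's \<Rightarrow> 'a"
  assumes H: "(\<lambda>(x, s). H x s) \<in> borel_measurable (borel \<Otimes>\<^sub>M P)"
  shows "(\<lambda>s. trajectory B H x0 s t) \<in> borel_measurable (Pi\<^sub>M {..<t} (\<lambda>_. P))"
proof (induction t)
  case (Suc t)
  let ?S = "Pi\<^sub>M {..<Suc t} (\<lambda>_. P)"
  have "(\<lambda>s. restrict s {..<t}) \<in> measurable ?S (Pi\<^sub>M {..<t} (\<lambda>_. P))"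
    by (rule measurable_restrict_subset) auto
  from measurable_compose[OF this Suc]
  have "(\<lambda>s. trajectory B H x0 (restrict s {..<t}) t) \<in> borel_measurable ?S" .
  then have past: "(\<lambda>s. trajectory B H x0 s t) \<in> borel_measurable ?S"
    by (simp add: trajectory_cong[of t "restrict _ {..<t}"])
  have "(\<lambda>s. (query t (trajectory B H x0 s t), s t)) \<in> measurable ?S (borel \<Otimes>\<^sub>M P)"
    by (intro measurable_Pair measurable_compose[OF past query_measurable] measurable_component_singleton) simp
  from measurable_compose[OF this H]
  have "(\<lambda>s. H (query t (trajectory B H x0 s t)) (s t)) \<in> borel_measurable ?S" by simp
  with past show ?case by (simp add: update_measurable)
qed simp

locale accelerated_run = smooth_convex \<Phi> g L + prob_space \<Omega>
  for \<Phi> :: "'a::euclidean_space \<Rightarrow> real" and g L and \<Omega> :: "'w measure" +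
  fixes P :: "'s measure" and H :: "'a \<Rightarrow> 's \<Rightarrow> 'a" and \<sigma> B :: real and x0 :: 'a
    and \<xi> :: "nat \<Rightarrow> 'w \<Rightarrow> 's" and T :: nat
  assumes estimator_measurable: "(\<lambda>(x, s). H x s) \<in> borel_measurable (borel \<Otimes>\<^sub>M P)"
    and estimator_integrable: "\<And>x. integrable P (H x)"
    and estimator_mean: "\<And>x. (\<integral>s. H x s \<partial>P) = g x"
    and estimator_error_integrable: "\<And>x. integrable P (\<lambda>s. (norm (g x - H x s))\<^sup>2)"
    and estimator_variance: "\<And>x. (\<integral>s. (norm (g x - H x s))\<^sup>2 \<partial>P) \<le> \<sigma>\<^sup>2"
    and samples_indep: "indep_vars (\<lambda>_. P) \<xi> {..<T}"
    and samples_dist: "\<And>t. t < T \<Longrightarrow> distr \<Omega> P (\<xi> t) = P"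
    and B_pos: "0 < B" and L_le_B: "L \<le> B"
begin

definition state :: "nat \<Rightarrow> 'w \<Rightarrow> 'a \<times> 'a" where
  "state t \<omega> = trajectory B H x0 (\<lambda>i. \<xi> i \<omega>) t"

definition error :: "nat \<Rightarrow> 'w \<Rightarrow> 'a" where
  "error t \<omega> = g (query t (state t \<omega>)) - H (query t (state t \<omega>)) (\<xi> t \<omega>)"

lemma state_0: "state 0 \<omega> = (x0, x0)"
  by (simp add: state_def)

lemma state_Suc: "state (Suc t) \<omega> = update B t (state t \<omega>) (g (query t (state t \<omega>)) - error t \<omega>)"
  by (simp add: state_def error_def)

lemma gradient_measurable [measurable]: "g \<in> borel_measurable borel"
  using lipschitz by (intro borel_measurable_continuous_onI lipschitz_on_continuous_on)

lemma sample_measurable: "t < T \<Longrightarrow> \<xi> t \<in> measurable \<Omega> P"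
  using samples_indep by (auto simp: indep_vars_def)

lemma state_eq: "state t \<omega> = trajectory B H x0 (restrict (\<lambda>i. \<xi> i \<omega>) {..<t}) t"
  unfolding state_def by (rule trajectory_cong) simp

lemma past_measurable:
  "t \<le> T \<Longrightarrow> (\<lambda>\<omega>. restrict (\<lambda>i. \<xi> i \<omega>) {..<t}) \<in> measurable \<Omega> (Pi\<^sub>M {..<t} (\<lambda>_. P))"
  by (intro measurable_restrict sample_measurable) auto

lemma state_measurable:
  assumes "t \<le> T"
  shows "state t \<in> borel_measurable \<Omega>"
  using measurable_compose[OF past_measurable[OF assms] trajectory_measurable[OF estimator_measurable]]
  by (simp add: state_eq[abs_def])

lemma state_independent_of_sample:
  assumes "t < T"
  shows "distr \<Omega> (borel \<Otimes>\<^sub>M P) (\<lambda>\<omega>. (state t \<omega>, \<xi> t \<omega>)) = distr \<Omega> borel (state t) \<Otimes>\<^sub>M P"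
proof -
  let ?past = "\<lambda>\<omega>. restrict (\<lambda>i. \<xi> i \<omega>) {..<t}" and ?now = "\<lambda>\<omega>. restrict (\<lambda>i. \<xi> i \<omega>) {t}"
  let ?SP = "Pi\<^sub>M {..<t} (\<lambda>_. P)" and ?SN = "Pi\<^sub>M {t} (\<lambda>_. P)"
  let ?f = "\<lambda>s. trajectory B H x0 s t" and ?h = "\<lambda>s::nat \<Rightarrow> 's. s t"
  have f: "?f \<in> measurable ?SP borel"
    by (rule trajectory_measurable[OF estimator_measurable])
  have h: "?h \<in> measurable ?SN P"
    by (rule measurable_component_singleton) simp
  have past: "?past \<in> measurable \<Omega> ?SP"
    using assms by (intro past_measurable) simp
  have now: "?now \<in> measurable \<Omega> ?SN"
    using assms by (intro measurable_restrict sample_measurable) auto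
  have "indep_var ?SP ?past ?SN ?now"
    using assms by (intro indep_var_restrict[OF samples_indep]) auto
  then have joint: "distr \<Omega> ?SP ?past \<Otimes>\<^sub>M distr \<Omega> ?SN ?now
      = distr \<Omega> (?SP \<Otimes>\<^sub>M ?SN) (\<lambda>\<omega>. (?past \<omega>, ?now \<omega>))"
    by (simp add: indep_var_distribution_eq)
  have dist_f: "distr (distr \<Omega> ?SP ?past) borel ?f = distr \<Omega> borel (state t)"
    by (simp add: distr_distr[OF f past] comp_def state_eq[abs_def])
  have dist_h: "distr (distr \<Omega> ?SN ?now) P ?h = P"
    by (simp add: distr_distr[OF h now] comp_def samples_dist[OF assms])
  have prob: "prob_space (distr (distr \<Omega> ?SN ?now) P ?h)"
    unfolding dist_h using prob_space_distr[OF sample_measurable[OF assms]] samples_dist[OF assms] by simp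
  have "distr \<Omega> borel (state t) \<Otimes>\<^sub>M P
      = distr (distr \<Omega> ?SP ?past) borel ?f \<Otimes>\<^sub>M distr (distr \<Omega> ?SN ?now) P ?h"
    by (simp only: dist_f dist_h)
  also have "\<dots> = distr (distr \<Omega> ?SP ?past \<Otimes>\<^sub>M distr \<Omega> ?SN ?now) (borel \<Otimes>\<^sub>M P) (\<lambda>(x, y). (?f x, ?h y))"
    using f h prob_space_imp_sigma_finite[OF prob]
    by (intro pair_measure_distr) simp_all
  also have "\<dots> = distr \<Omega> (borel \<Otimes>\<^sub>M P) ((\<lambda>(x, y). (?f x, ?h y)) \<circ> (\<lambda>\<omega>. (?past \<omega>, ?now \<omega>)))"
  proof -
    have "(\<lambda>(x, y). (?f x, ?h y)) \<in> measurable (?SP \<Otimes>\<^sub>M ?SN) (borel \<Otimes>\<^sub>M P)"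
      unfolding case_prod_unfold
      by (intro measurable_Pair measurable_compose[OF measurable_fst f] measurable_compose[OF measurable_snd h])
    moreover have "(\<lambda>\<omega>. (?past \<omega>, ?now \<omega>)) \<in> measurable \<Omega> (?SP \<Otimes>\<^sub>M ?SN)"
      using past now by (rule measurable_Pair)
    ultimately show ?thesis
      unfolding joint by (rule distr_distr)
  qed
  also have "(\<lambda>(x, y). (?f x, ?h y)) \<circ> (\<lambda>\<omega>. (?past \<omega>, ?now \<omega>)) = (\<lambda>\<omega>. (state t \<omega>, \<xi> t \<omega>))"
    by (simp add: comp_def state_eq)
  finally show ?thesis ..
qed

lemma estimator_error_measurable:
  "(\<lambda>q. g (query t (fst q)) - H (query t (fst q)) (snd q)) \<in> borel_measurable (borel \<Otimes>\<^sub>M P)"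
proof -
  have query: "(\<lambda>q. query t (fst q :: 'a \<times> 'a)) \<in> measurable (borel \<Otimes>\<^sub>M P) borel"
    by (rule measurable_compose[OF measurable_fst query_measurable])
  have "(\<lambda>q. (query t (fst q :: 'a \<times> 'a), snd q)) \<in> measurable (borel \<Otimes>\<^sub>M P) (borel \<Otimes>\<^sub>M P)"
    by (intro measurable_Pair query measurable_snd)
  from measurable_compose[OF this estimator_measurable]
  have "(\<lambda>q. H (query t (fst q)) (snd q)) \<in> borel_measurable (borel \<Otimes>\<^sub>M P)" by simp
  with measurable_compose[OF query gradient_measurable] show ?thesis
    by (rule borel_measurable_diff)
qed

lemma error_square_integrable: "t < T \<Longrightarrow> square_integrable \<Omega> (error t)"
  and error_variance: "t < T \<Longrightarrow> (\<integral>\<omega>. (norm (error t \<omega>))\<^sup>2 \<partial>\<Omega>) \<le> \<sigma>\<^sup>2"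
proof -
  assume t: "t < T"
  let ?k = "\<lambda>q. (norm (g (query t (fst q)) - H (query t (fst q)) (snd q)))\<^sup>2"
  have k: "?k \<in> borel_measurable (borel \<Otimes>\<^sub>M P)"
    by (intro borel_measurable_power measurable_compose[OF estimator_error_measurable borel_measurable_norm])
  have state: "state t \<in> measurable \<Omega> borel"
    using t by (intro state_measurable) simp
  note sample = sample_measurable[OF t]
  note facts = integrable_independent_sample[OF state sample samples_dist[OF t]
      state_independent_of_sample[OF t] k, of "\<sigma>\<^sup>2", simplified,
      OF estimator_error_integrable estimator_variance]
  have "error t \<in> borel_measurable \<Omega>"
    using measurable_compose[OF measurable_Pair[OF state sample] estimator_error_measurable]
    by (simp add: error_def[abs_def])
  with facts show "square_integrable \<Omega> (error t)" "(\<integral>\<omega>. (norm (error t \<omega>))\<^sup>2 \<partial>\<Omega>) \<le> \<sigma>\<^sup>2"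
    by (simp_all add: square_integrable_def error_def)
qed

lemma square_integrable_state:
  "t \<le> T \<Longrightarrow> square_integrable \<Omega> (\<lambda>\<omega>. fst (state t \<omega>)) \<and> square_integrable \<Omega> (\<lambda>\<omega>. snd (state t \<omega>))"
proof (induction t)
  case 0
  then show ?case by (simp add: state_0 square_integrable_const)
next
  case (Suc t)
  then have IH: "square_integrable \<Omega> (\<lambda>\<omega>. fst (state t \<omega>))" "square_integrable \<Omega> (\<lambda>\<omega>. snd (state t \<omega>))"
    and t: "t < T" by auto
  have "square_integrable \<Omega> (\<lambda>\<omega>. query t (state t \<omega>))"
    unfolding query_def case_prod_unfold by (intro square_integrable_add square_integrable_scaleR IH)
  then have "square_integrable \<Omega> (\<lambda>\<omega>. g (query t (state t \<omega>)) - error t \<omega>)"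
    by (intro square_integrable_diff square_integrable_lipschitz[OF _ lipschitz] error_square_integrable t)
  note z = square_integrable_diff[OF IH(2) square_integrable_scaleR[OF this]]
  note x = square_integrable_add[OF square_integrable_scaleR[OF IH(1)] square_integrable_scaleR[OF z]]
  show ?case
    unfolding state_Suc update_def case_prod_unfold Let_def fst_conv snd_conv
    using z x by blast
qed

lemma square_integrable_gradient:
  assumes "t \<le> T"
  shows "square_integrable \<Omega> (\<lambda>\<omega>. g (query t (state t \<omega>)))"
proof -
  have "square_integrable \<Omega> (\<lambda>\<omega>. query t (state t \<omega>))"
    unfolding query_def case_prod_unfold
    using square_integrable_state[OF assms] by (intro square_integrable_add square_integrable_scaleR) auto
  then show ?thesis by (rule square_integrable_lipschitz[OF _ lipschitz])
qed

text \<open>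
  The minorant and the majorant at \<open>0\<close> enclose \<open>\<Phi>\<close> between an affine and a quadratic function.
\<close>

lemma integrable_objective:
  assumes X: "square_integrable \<Omega> X"
  shows "integrable \<Omega> (\<lambda>\<omega>. \<Phi> (X \<omega>))"
proof -
  have "\<Phi> differentiable (at x)" for x
    using gradient[of x] unfolding gderiv_def differentiable_def by blast
  then have "continuous_on UNIV \<Phi>"
    by (intro differentiable_imp_continuous_on) (simp add: differentiable_on_def)
  then have \<Phi>: "\<Phi> \<in> borel_measurable borel" by (rule borel_measurable_continuous_onI)
  have X_meas: "X \<in> borel_measurable \<Omega>" and X2: "integrable \<Omega> (\<lambda>\<omega>. (norm (X \<omega>))\<^sup>2)"
    using X by (simp_all add: square_integrable_def)
  have lin: "integrable \<Omega> (\<lambda>\<omega>. \<Phi> 0 + g 0 \<bullet> X \<omega>)"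
    using square_integrable_inner[OF square_integrable_const[of "g 0"] X] by simp
  have quad: "integrable \<Omega> (\<lambda>\<omega>. L / 2 * (norm (X \<omega>))\<^sup>2)"
    using X2 by simp
  have "integrable \<Omega> (\<lambda>\<omega>. \<Phi> (X \<omega>) - (\<Phi> 0 + g 0 \<bullet> X \<omega>))"
  proof (rule integrable_dominated[OF quad])
    show "(\<lambda>\<omega>. \<Phi> (X \<omega>) - (\<Phi> 0 + g 0 \<bullet> X \<omega>)) \<in> borel_measurable \<Omega>"
      using borel_measurable_integrable[OF lin]
      by (intro borel_measurable_diff measurable_compose[OF X_meas \<Phi>])
    show "0 \<le> \<Phi> (X \<omega>) - (\<Phi> 0 + g 0 \<bullet> X \<omega>)"
      and "\<Phi> (X \<omega>) - (\<Phi> 0 + g 0 \<bullet> X \<omega>) \<le> L / 2 * (norm (X \<omega>))\<^sup>2" for \<omega>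
      using minorant[of 0 "X \<omega>"] majorant[of "X \<omega>" 0] by simp_all
  qed
  from Bochner_Integration.integrable_add[OF this lin] show ?thesis by simp
qed

text \<open>
  For a fixed state the error averages to zero over the sample, whereas \<open>C\<close> depends on the state only.
\<close>

lemma error_uncorrelated:
  assumes t: "t < T" and C: "C \<in> borel_measurable borel" "square_integrable \<Omega> (\<lambda>\<omega>. C (state t \<omega>))"
  shows "(\<integral>\<omega>. error t \<omega> \<bullet> C (state t \<omega>) \<partial>\<Omega>) = 0"
proof -
  let ?k = "\<lambda>q. (g (query t (fst q)) - H (query t (fst q)) (snd q)) \<bullet> C (fst q)"
  have k: "?k \<in> borel_measurable (borel \<Otimes>\<^sub>M P)"
    by (intro borel_measurable_inner estimator_error_measurable measurable_compose[OF measurable_fst C(1)])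
  have state: "state t \<in> measurable \<Omega> borel"
    using t by (intro state_measurable) simp
  have "integrable \<Omega> (\<lambda>\<omega>. error t \<omega> \<bullet> C (state t \<omega>))"
    by (rule square_integrable_inner[OF error_square_integrable[OF t] C(2)])
  then have "(\<integral>\<omega>. error t \<omega> \<bullet> C (state t \<omega>) \<partial>\<Omega>) = (\<integral>\<omega>. (\<integral>s. ?k (state t \<omega>, s) \<partial>P) \<partial>\<Omega>)"
    using integral_independent_sample[OF state sample_measurable[OF t] samples_dist[OF t]
        state_independent_of_sample[OF t] k]
    by (simp add: error_def)
  also have "\<dots> = 0"
  proof -
    have P: "prob_space P"
      using prob_space_distr[OF sample_measurable[OF t]] samples_dist[OF t] by simp
    then interpret P: prob_space P .
    have "(\<integral>s. (g x - H x s) \<bullet> v \<partial>P) = 0" for x v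
    proof -
      have "(\<integral>s. g x - H x s \<partial>P) = 0"
        by (simp add: Bochner_Integration.integral_diff estimator_integrable estimator_mean P.prob_space)
      moreover have "(\<integral>s. (g x - H x s) \<bullet> v \<partial>P) = (\<integral>s. g x - H x s \<partial>P) \<bullet> v"
        by (rule integral_inner_left) (simp add: estimator_integrable)
      ultimately show ?thesis by simp
    qed
    then show ?thesis by simp
  qed
  finally show ?thesis .
qed

lemma integrable_potential:
  assumes "t \<le> T"
  shows "integrable \<Omega> (\<lambda>\<omega>. potential B u t (state t \<omega>))"
proof -
  have x: "square_integrable \<Omega> (\<lambda>\<omega>. fst (state t \<omega>))" and z: "square_integrable \<Omega> (\<lambda>\<omega>. snd (state t \<omega>))"
    using square_integrable_state[OF assms] by auto
  have "integrable \<Omega> (\<lambda>\<omega>. (norm (snd (state t \<omega>) - u))\<^sup>2)"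
    "integrable \<Omega> (\<lambda>\<omega>. (norm (snd (state t \<omega>) - fst (state t \<omega>)))\<^sup>2)"
    using square_integrable_diff[OF z square_integrable_const[of u]] square_integrable_diff[OF z x]
    by (simp_all add: square_integrable_def)
  then show ?thesis
    unfolding potential_def case_prod_unfold using integrable_objective[OF x] by simp
qed

lemma correlation_measurable:
  "final_correlation B t \<in> borel_measurable borel" "correlation B u t \<in> borel_measurable borel"
proof -
  have g: "(\<lambda>p. g (query t p)) \<in> borel_measurable borel"
    by (rule measurable_compose[OF query_measurable gradient_measurable])
  have [measurable]: "(fst :: 'a \<times> 'a \<Rightarrow> 'a) \<in> borel_measurable borel"
    "(snd :: 'a \<times> 'a \<Rightarrow> 'a) \<in> borel_measurable borel"
    by (auto intro!: borel_measurable_continuous_onI continuous_intros)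
  note [measurable] = g
  show fin: "final_correlation B t \<in> borel_measurable borel"
    unfolding final_correlation_def by measurable
  note [measurable] = this
  show "correlation B u t \<in> borel_measurable borel"
    unfolding correlation_def case_prod_unfold Let_def prod.collapse by measurable
qed

lemma correlation_square_integrable:
  assumes "t \<le> T"
  shows "square_integrable \<Omega> (\<lambda>\<omega>. final_correlation B t (state t \<omega>))"
    and "square_integrable \<Omega> (\<lambda>\<omega>. correlation B u t (state t \<omega>))"
proof -
  note facts = square_integrable_state[OF assms, THEN conjunct1]
    square_integrable_state[OF assms, THEN conjunct2] square_integrable_gradient[OF assms]
    square_integrable_const
  show "square_integrable \<Omega> (\<lambda>\<omega>. final_correlation B t (state t \<omega>))"
    unfolding final_correlation_def by (intro square_integrable_scaleR facts)
  then show "square_integrable \<Omega> (\<lambda>\<omega>. correlation B u t (state t \<omega>))"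
    unfolding correlation_def case_prod_unfold Let_def prod.collapse
    by (intro square_integrable_add square_integrable_diff square_integrable_scaleR facts)
qed

lemma expected_noise:
  assumes t: "t < T" and C: "C \<in> borel_measurable borel" "square_integrable \<Omega> (\<lambda>\<omega>. C (state t \<omega>))"
    and "0 \<le> r" and V: "integrable \<Omega> V" and W: "integrable \<Omega> W"
    and le: "\<And>\<omega>. V \<omega> \<le> W \<omega> + r * (norm (error t \<omega>))\<^sup>2 + error t \<omega> \<bullet> C (state t \<omega>)"
  shows "(\<integral>\<omega>. V \<omega> \<partial>\<Omega>) \<le> (\<integral>\<omega>. W \<omega> \<partial>\<Omega>) + r * \<sigma>\<^sup>2"
proof -
  have e2: "integrable \<Omega> (\<lambda>\<omega>. r * (norm (error t \<omega>))\<^sup>2)"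
    using error_square_integrable[OF t] by (simp add: square_integrable_def)
  note eC = square_integrable_inner[OF error_square_integrable[OF t] C(2)]
  have "(\<integral>\<omega>. V \<omega> \<partial>\<Omega>)
      \<le> (\<integral>\<omega>. W \<omega> + r * (norm (error t \<omega>))\<^sup>2 + error t \<omega> \<bullet> C (state t \<omega>) \<partial>\<Omega>)"
    using V W e2 eC le by (intro integral_mono Bochner_Integration.integrable_add) auto
  also have "\<dots> = (\<integral>\<omega>. W \<omega> \<partial>\<Omega>) + r * (\<integral>\<omega>. (norm (error t \<omega>))\<^sup>2 \<partial>\<Omega>)"
    using W e2 eC by (simp add: Bochner_Integration.integral_add error_uncorrelated[OF t C])
  also have "\<dots> \<le> (\<integral>\<omega>. W \<omega> \<partial>\<Omega>) + r * \<sigma>\<^sup>2"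
    using error_variance[OF t] \<open>0 \<le> r\<close> by (simp add: mult_left_mono)
  finally show ?thesis .
qed

lemma L_nonneg: "0 \<le> L"
  using lipschitz by (rule lipschitz_on_nonneg)

text \<open>
  The cubic factor is the sum of \<open>weight (s + 1)\<close> over \<open>s < t\<close>.
\<close>

lemma expected_potential:
  "t \<le> T \<Longrightarrow> (\<integral>\<omega>. potential B u t (state t \<omega>) \<partial>\<Omega>)
    \<le> B / 2 * (norm (x0 - u))\<^sup>2
      + real t * (real t + 1) * (real t + 5) / 12 * ((B + L) / (2 * B\<^sup>2)) * \<sigma>\<^sup>2"
proof (induction t)
  case 0
  then show ?case
    by (simp add: state_0 potential_def weight_def inertia_def prob_space)
next
  case (Suc t)
  then have t: "t < T" by simp
  let ?r = "weight (Suc t) * (B + L) / (2 * B\<^sup>2)"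
  have "(\<integral>\<omega>. potential B u (Suc t) (state (Suc t) \<omega>) \<partial>\<Omega>)
      \<le> (\<integral>\<omega>. potential B u t (state t \<omega>) \<partial>\<Omega>) + ?r * \<sigma>\<^sup>2"
  proof (rule expected_noise[OF t, where C = "correlation B u t"])
    show "potential B u (Suc t) (state (Suc t) \<omega>) \<le> potential B u t (state t \<omega>)
        + ?r * (norm (error t \<omega>))\<^sup>2 + error t \<omega> \<bullet> correlation B u t (state t \<omega>)" for \<omega>
      using potential_step[OF B_pos L_le_B, of u t "state t \<omega>" "g (query t (state t \<omega>)) - error t \<omega>"]
      by (simp add: state_Suc)
    show "0 \<le> ?r" using B_pos L_nonneg weight_nonneg by simp
  qed (use t in \<open>auto intro: correlation_measurable correlation_square_integrable integrable_potential\<close>)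
  also have "\<dots> \<le> B / 2 * (norm (x0 - u))\<^sup>2
      + real t * (real t + 1) * (real t + 5) / 12 * ((B + L) / (2 * B\<^sup>2)) * \<sigma>\<^sup>2 + ?r * \<sigma>\<^sup>2"
    using Suc by simp
  also have "\<dots> = B / 2 * (norm (x0 - u))\<^sup>2
      + (real t * (real t + 1) * (real t + 5) / 12 + weight (Suc t)) * ((B + L) / (2 * B\<^sup>2)) * \<sigma>\<^sup>2"
    by (simp add: algebra_simps)
  also have "real t * (real t + 1) * (real t + 5) / 12 + weight (Suc t)
      = real (Suc t) * (real (Suc t) + 1) * (real (Suc t) + 5) / 12"
    by (simp add: weight_def field_simps)
  finally show ?case .
qed

text \<open>
  The comparison point is arbitrary because it will be a minimizer of the objective before smoothing,
  at which \<open>\<Phi>\<close> can exceed its values along the iteration. The last summand is the noise of the final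
  step, by \<open>final_potential_step\<close>.
\<close>

theorem expected_suboptimality:
  assumes "N < T"
  shows "integrable \<Omega> (\<lambda>\<omega>. \<Phi> (fst (state (Suc N) \<omega>)))"
    and "weight (Suc N) * ((\<integral>\<omega>. \<Phi> (fst (state (Suc N) \<omega>)) \<partial>\<Omega>) - \<Phi> u)
      \<le> B / 2 * (norm (x0 - u))\<^sup>2
        + real N * (real N + 1) * (real N + 5) / 12 * ((B + L) / (2 * B\<^sup>2)) * \<sigma>\<^sup>2
        + weight (Suc N) * L / (2 * B\<^sup>2) * \<sigma>\<^sup>2"
proof -
  show int: "integrable \<Omega> (\<lambda>\<omega>. \<Phi> (fst (state (Suc N) \<omega>)))"
    using square_integrable_state[of "Suc N"] assms by (intro integrable_objective) auto
  let ?r = "weight (Suc N) * L / (2 * B\<^sup>2)"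
  have "weight (Suc N) * ((\<integral>\<omega>. \<Phi> (fst (state (Suc N) \<omega>)) \<partial>\<Omega>) - \<Phi> u)
      = (\<integral>\<omega>. weight (Suc N) * (\<Phi> (fst (state (Suc N) \<omega>)) - \<Phi> u) \<partial>\<Omega>)"
    using int by (simp add: Bochner_Integration.integral_diff prob_space)
  also have "\<dots> \<le> (\<integral>\<omega>. potential B u N (state N \<omega>) \<partial>\<Omega>) + ?r * \<sigma>\<^sup>2"
  proof (rule expected_noise[OF assms, where C = "final_correlation B N"])
    show "weight (Suc N) * (\<Phi> (fst (state (Suc N) \<omega>)) - \<Phi> u) \<le> potential B u N (state N \<omega>)
        + ?r * (norm (error N \<omega>))\<^sup>2 + error N \<omega> \<bullet> final_correlation B N (state N \<omega>)" for \<omega>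
      using final_potential_step[OF B_pos L_le_B, of N "state N \<omega>" "g (query N (state N \<omega>)) - error N \<omega>" u]
      by (simp add: state_Suc)
    show "0 \<le> ?r" using L_nonneg weight_nonneg by simp
  qed (use assms int in \<open>auto intro: correlation_measurable correlation_square_integrable integrable_potential\<close>)
  also have "\<dots> \<le> B / 2 * (norm (x0 - u))\<^sup>2
        + real N * (real N + 1) * (real N + 5) / 12 * ((B + L) / (2 * B\<^sup>2)) * \<sigma>\<^sup>2 + ?r * \<sigma>\<^sup>2"
    using expected_potential[of N u] assms by simp
  finally show "weight (Suc N) * ((\<integral>\<omega>. \<Phi> (fst (state (Suc N) \<omega>)) \<partial>\<Omega>) - \<Phi> u)
      \<le> B / 2 * (norm (x0 - u))\<^sup>2
        + real N * (real N + 1) * (real N + 5) / 12 * ((B + L) / (2 * B\<^sup>2)) * \<sigma>\<^sup>2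
        + weight (Suc N) * L / (2 * B\<^sup>2) * \<sigma>\<^sup>2" .
qed

end

section \<open>Algorithm SSG\<close>

lemma proximal_step:
  fixes w z :: "'a::real_inner"
  assumes "k > 0"
  shows "arg_min (\<lambda>u. u \<bullet> w + k / 2 * (norm (u - z))\<^sup>2) (\<lambda>u. True) = z - (1 / k) *\<^sub>R w"
proof -
  let ?q = "\<lambda>u. u \<bullet> w + k / 2 * (norm (u - z))\<^sup>2" and ?p = "z - (1 / k) *\<^sub>R w"
  \<comment> \<open>Completing the square.\<close>
  have q: "?q u = ?q ?p + k / 2 * (norm (u - ?p))\<^sup>2" for u
  proof -
    have "u - z = (u - ?p) - (1 / k) *\<^sub>R w" by simp
    then have "(norm (u - z))\<^sup>2 = (norm (u - ?p))\<^sup>2 - 2 / k * ((u - ?p) \<bullet> w) + (norm ((1 / k) *\<^sub>R w))\<^sup>2"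
      by (simp only: power2_norm_eq_inner) (simp add: inner_commute algebra_simps)
    moreover have "?p - z = - ((1 / k) *\<^sub>R w)" by simp
    then have "(norm (?p - z))\<^sup>2 = (norm ((1 / k) *\<^sub>R w))\<^sup>2" by (simp only: norm_minus_cancel)
    ultimately have "k / 2 * (norm (u - z))\<^sup>2
        = k / 2 * (norm (u - ?p))\<^sup>2 - (u - ?p) \<bullet> w + k / 2 * (norm (?p - z))\<^sup>2"
      using assms by (simp add: ring_distribs del: norm_scaleR)
    then show ?thesis using inner_diff_left[of u ?p w] by linarith
  qed
  have "?q ?p \<le> ?q u" for u
    using assms q[of u] by (simp only: le_add_same_cancel1) simp
  then have "is_arg_min ?q (\<lambda>u. True) ?p"
    by (simp add: is_arg_min_def not_less)
  moreover have "u = ?p" if "is_arg_min ?q (\<lambda>u. True) u" for u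
  proof -
    have "\<not> ?q ?p < ?q u" using that unfolding is_arg_min_def by blast
    then have "k / 2 * (norm (u - ?p))\<^sup>2 \<le> 0" using q[of u] by linarith
    then show ?thesis using assms by (simp add: mult_le_0_iff)
  qed
  ultimately show ?thesis
    unfolding arg_min_def by (rule some_equality)
qed

text \<open>
  Since \<open>\<gamma>\<^sub>t L\<^sub>\<mu> = \<theta>\<^sub>t (N\<^bsup>3/2\<^esup> + 2 L\<^sub>\<mu>)\<close>, the proximal step of the algorithm is a gradient step of
  the accelerated iteration with \<open>B = N\<^bsup>3/2\<^esup> + 2 L\<^sub>\<mu>\<close>, applied to the smoothed objective.
\<close>

lemma ssg_eq_trajectory:
  fixes A :: "real^'n^'m" and G :: "real^'n \<Rightarrow> 's \<Rightarrow> real^'n"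
  assumes "L_smooth A c L \<mu> > 0"
  shows "ssg A Q d c G N L \<mu> s t
    = trajectory (real N powr (3/2) + 2 * L_smooth A c L \<mu>)
        (\<lambda>y \<zeta>. G y \<zeta> + transpose A *v v_smooth A Q d \<mu> y) 0 s t"
proof (induction t)
  case (Suc t)
  let ?B = "real N powr (3/2) + 2 * L_smooth A c L \<mu>"
  have k: "\<gamma>_step N (L_smooth A c L \<mu>) t * L_smooth A c L \<mu> = \<theta>_step t * ?B"
  proof -
    have "(a / l + 2) * l = a + 2 * l" if "l > 0" for a l :: real
      using that by (simp add: distrib_right)
    from this[OF assms] show ?thesis
      by (simp only: \<gamma>_step_def \<theta>_step_def mult.assoc)
  qed
  have B: "?B > 0" using assms by (simp add: add_nonneg_pos)
  have pos: "\<theta>_step t * ?B > 0"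
    by (rule mult_pos_pos[OF _ B]) (simp add: \<theta>_step_def)
  show ?case
    by (simp only: ssg.simps trajectory.simps Suc update_def query_def case_prod_unfold Let_def k
        proximal_step[OF pos])
qed simp

text \<open>
  The bias term contributes \<open>2 B / (N + 2)\<^sup>2\<close> times the squared distance; the part \<open>N\<^bsup>3/2\<^esup>\<close> of \<open>B\<close> is
  absorbed by \<open>(N + 2)\<^bsup>3/2\<^esup>\<close>. In the noise term \<open>2 l \<le> B\<close> bounds the two coefficients by
  \<open>3 / (4 B)\<close> and \<open>1 / (4 B)\<close>, and \<open>B \<ge> N\<^bsup>3/2\<^esup>\<close> leaves at most \<open>(11 / 20) / sqrt N\<close>, which is below
  \<open>1 / sqrt (N + 2)\<close> because \<open>(11 / 20)\<^sup>2 (N + 2) \<le> N\<close> for all \<open>N \<ge> 1\<close>.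
\<close>

lemma rate_arithmetic:
  fixes N :: nat and l S D2 e :: real
  defines "B \<equiv> real N * sqrt (real N) + 2 * l"
  assumes N: "1 \<le> N" and l: "0 \<le> l" and "0 \<le> S" "0 \<le> D2"
    and e: "weight (Suc N) * e \<le> B / 2 * D2
        + real N * (real N + 1) * (real N + 5) / 12 * ((B + l) / (2 * B\<^sup>2)) * S
        + weight (Suc N) * l / (2 * B\<^sup>2) * S"
  shows "e \<le> (2 * D2 + S) / sqrt (real N + 2) + 4 * l * D2 / (real N + 2)\<^sup>2"
proof -
  define n where "n = real N"
  have n: "1 \<le> n" using N by (simp add: n_def)
  define r q where "r = sqrt n" and "q = sqrt (n + 2)"
  have r: "1 \<le> r" "r * r = n" and q: "1 \<le> q" "q * q = n + 2" "r \<le> q"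
    using n by (simp_all add: r_def q_def)
  have B: "B = n * r + 2 * l" by (simp add: B_def n_def r_def)
  have "0 < n * r" using n r by simp
  then have B_pos: "0 < B" and lB: "2 * l \<le> B" and nB: "n * r \<le> B" using l by (simp_all add: B)
  define w where "w = (n + 1) * (n + 4) / 4"
  have w: "weight (Suc N) = w" by (simp add: weight_def w_def n_def algebra_simps)
  have w_ge: "(n + 2)\<^sup>2 / 4 \<le> w" using n by (simp add: w_def power2_eq_square algebra_simps)
  have w_pos: "0 < w" using n by (simp add: w_def)
  define c1 where "c1 = (B + l) / (2 * B\<^sup>2)"
  define c2 where "c2 = l / (2 * B\<^sup>2)"
  have c: "c1 \<le> 3 / (4 * B)" "c2 \<le> 1 / (4 * B)"
    using B_pos lB by (simp_all add: c1_def c2_def divide_simps power2_eq_square)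
  have bias: "B / 2 * D2 \<le> w * (2 * D2 / q + 4 * l * D2 / (n + 2)\<^sup>2)"
  proof -
    have "B * q \<le> (n + 2)\<^sup>2 + 2 * l * q"
    proof -
      have "n * r * q \<le> (n + 2) * q * q"
        using n r q by (intro mult_right_mono mult_mono) auto
      also have "\<dots> = (n + 2)\<^sup>2" using q by (simp add: power2_eq_square mult.assoc)
      finally show ?thesis by (simp add: B algebra_simps)
    qed
    then have "B \<le> (n + 2)\<^sup>2 / q + 2 * l"
      using q by (simp add: field_simps)
    then have "B / 2 * D2 \<le> ((n + 2)\<^sup>2 / q + 2 * l) / 2 * D2"
      using \<open>0 \<le> D2\<close> by (intro mult_right_mono) auto
    also have "\<dots> = (n + 2)\<^sup>2 / 4 * (2 * D2 / q + 4 * l * D2 / (n + 2)\<^sup>2)"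
      using n by (simp add: distrib_left add_divide_distrib distrib_right mult.commute)
    also have "\<dots> \<le> w * (2 * D2 / q + 4 * l * D2 / (n + 2)\<^sup>2)"
      using w_ge q l \<open>0 \<le> D2\<close> by (intro mult_right_mono add_nonneg_nonneg) auto
    finally show ?thesis .
  qed
  have "n * (n + 1) * (n + 5) / 12 * c1 + w * c2 \<le> w * (1 / q)"
  proof -
    have "n * (n + 1) * (n + 5) / 12 = (n * (n + 5)) * ((n + 1) / 12)" by simp
    also have "\<dots> \<le> (2 / 5 * n * (n + 4) * 3) * ((n + 1) / 12)"
    proof (rule mult_right_mono)
      have "n * 1 \<le> n * n" using n by (intro mult_left_mono) auto
      then show "n * (n + 5) \<le> 2 / 5 * n * (n + 4) * 3" by (simp add: algebra_simps)
    qed (use n in simp)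
    also have "\<dots> = w * (2 / 5 * n)" by (simp add: w_def field_simps)
    finally have sum: "n * (n + 1) * (n + 5) / 12 \<le> w * (2 / 5 * n)" .
    have "n * (n + 1) * (n + 5) / 12 * c1 \<le> w * (2 / 5 * n) * (3 / (4 * B))"
      using sum c(1) n w_pos l B_pos by (intro mult_mono) (auto simp: c1_def)
    moreover have "w * c2 \<le> w * (1 / (4 * B))"
      using c(2) w_pos by (intro mult_left_mono) auto
    ultimately have "n * (n + 1) * (n + 5) / 12 * c1 + w * c2 \<le> w * ((3 / 10 * n + 1 / 4) / B)"
      using B_pos by (simp add: field_simps)
    also have "(3 / 10 * n + 1 / 4) / B \<le> 1 / q"
    proof -
      have "11 / 20 * q \<le> r"
      proof (rule power2_le_imp_le)
        show "(11 / 20 * q)\<^sup>2 \<le> r\<^sup>2"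
          using n r q by (simp add: power2_eq_square)
      qed (use r in simp)
      then have "n * (11 / 20 * q) \<le> n * r" using n by (intro mult_left_mono) auto
      moreover have "(3 / 10 * n + 1 / 4) * q \<le> (n * (11 / 20)) * q"
        using n q by (intro mult_right_mono) auto
      ultimately have "(3 / 10 * n + 1 / 4) * q \<le> B" using nB by simp
      then show ?thesis using B_pos q by (simp add: field_simps)
    qed
    finally show ?thesis using w_pos by (simp add: mult_left_mono)
  qed
  from mult_right_mono[OF this \<open>0 \<le> S\<close>]
  have noise: "n * (n + 1) * (n + 5) / 12 * c1 * S + w * c2 * S \<le> w * (S / q)"
    by (simp add: distrib_right)
  have "w * e \<le> B / 2 * D2 + (n * (n + 1) * (n + 5) / 12 * c1 * S + w * c2 * S)"
    using e unfolding w n_def[symmetric] c1_def c2_def by simp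
  with bias noise have "w * e \<le> w * ((2 * D2 + S) / q + 4 * l * D2 / (n + 2)\<^sup>2)"
    by (simp add: distrib_left add_divide_distrib)
  then show ?thesis
    using w_pos by (simp add: q_def n_def)
qed

theorem theorem2:
  fixes f :: "real^'n \<Rightarrow> real" and grad_f :: "real^'n \<Rightarrow> real^'n"
    and h \<phi> :: "real^'n \<Rightarrow> real"
    and A :: "real^'n^'m" and Q :: "(real^'m) set" and d :: "real^'m \<Rightarrow> real"
    and P :: "'s measure" and F :: "real^'n \<Rightarrow> 's \<Rightarrow> real" and G :: "real^'n \<Rightarrow> 's \<Rightarrow> real^'n"
    and \<Omega> :: "'w measure" and \<xi> :: "nat \<Rightarrow> 'w \<Rightarrow> 's"
    and L c M \<sigma> \<mu> D :: real and N :: nat and x_opt :: "real^'n"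
  assumes \<comment> \<open>\<open>P\<close> is the distribution of the random variable underlying \<open>f\<close>\<close>
    "prob_space P"
    and "\<And>x. integrable P (F x)" and "\<And>x. f x = (\<integral>s. F x s \<partial>P)"
    and "convex_on UNIV f" and "\<And>x. GDERIV f x :> grad_f x"
    and "L > 0" and "L-lipschitz_on UNIV grad_f"
    and "Q \<noteq> {}" and "compact Q" and "convex Q" and "A \<noteq> 0"
    and "\<And>x. h x = (SUP v\<in>Q. v \<bullet> (A *v x))"
    and "\<And>x. \<phi> x = f x + h x"
    and "cont_differentiable_on d Q" and "\<And>v. v \<in> Q \<Longrightarrow> d v \<ge> 0"
    and "c > 0" and "strongly_convex_on Q c d"
    and "M = (SUP v\<in>Q. d v)"
    and "(\<lambda>(x, s). G x s) \<in> borel_measurable (borel \<Otimes>\<^sub>M P)"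
    and "\<And>x. integrable P (G x)" and "\<And>x. (\<integral>s. G x s \<partial>P) = grad_f x"
    and "\<sigma> \<ge> 0"
    and "\<And>x. integrable P (\<lambda>s. (norm (grad_f x - G x s))\<^sup>2)"
    and "\<And>x. (\<integral>s. (norm (grad_f x - G x s))\<^sup>2 \<partial>P) \<le> \<sigma>\<^sup>2"
    and "\<And>x. \<phi> x_opt \<le> \<phi> x"
    and "N \<ge> 1"
    and \<comment> \<open>the samples drawn by the algorithm\<close>
    "prob_space \<Omega>"
    and "prob_space.indep_vars \<Omega> (\<lambda>_. P) \<xi> {0..N}"
    and "\<And>t. t \<le> N \<Longrightarrow> distr \<Omega> P (\<xi> t) = P"
    and "\<mu> = spectral_norm A / (real N + 2)"
    and "D = norm (x_opt - 0)" \<comment> \<open>the algorithm starts at \<open>z\<^sub>0 = 0\<close>\<close>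
  shows "integrable \<Omega> (\<lambda>\<omega>. \<phi> (ssg_output A Q d c G N L \<mu> (\<lambda>t. \<xi> t \<omega>)))
    \<and> (\<integral>\<omega>. \<phi> (ssg_output A Q d c G N L \<mu> (\<lambda>t. \<xi> t \<omega>)) \<partial>\<Omega>) - \<phi> x_opt
      \<le> (2 * D\<^sup>2 + \<sigma>\<^sup>2) / (real N + 2) powr (1/2)
        + L * ((4 * D\<^sup>2 + 2 * \<sigma>\<^sup>2) / (real N + 2)\<^sup>2)
        + spectral_norm A / (real N + 2) * (M + (4 * D\<^sup>2 + 2 * \<sigma>\<^sup>2) / c)"
proof -
  interpret P: prob_space P by fact
  interpret \<Omega>: prob_space \<Omega> by fact
  have A_pos: "spectral_norm A > 0" using \<open>A \<noteq> 0\<close> by (rule spectral_norm_pos)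
  then have \<mu>: "\<mu> > 0" using \<open>\<mu> = spectral_norm A / (real N + 2)\<close> by simp
  interpret S: smoothing A Q d c \<mu>
    using assms(8,9,16,17) cont_differentiable_on_imp_continuous_on[OF assms(14)] \<mu>
    by unfold_locales
  define l where "l = L_smooth A c L \<mu>"
  have l: "l = L + (spectral_norm A)\<^sup>2 / (c * \<mu>)" by (simp add: l_def L_smooth_def)
  have l_pos: "0 < l" using \<open>L > 0\<close> \<open>c > 0\<close> \<mu> unfolding l by (simp add: add_pos_nonneg)
  define B where "B = real N powr (3/2) + 2 * l"
  define \<Phi> where "\<Phi> x = f x + S.smoothed x" for x
  define g where "g x = grad_f x + transpose A *v v_smooth A Q d \<mu> x" for x
  define H where "H x s = G x s + transpose A *v v_smooth A Q d \<mu> x" for x s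
  define X where "X \<omega> = ssg_output A Q d c G N L \<mu> (\<lambda>t. \<xi> t \<omega>)" for \<omega>
  have smooth: "smooth_convex \<Phi> g l"
  proof
    show "convex_on UNIV \<Phi>"
      unfolding \<Phi>_def[abs_def] using assms(4) S.smoothed_convex by (rule convex_on_add)
    show "GDERIV \<Phi> x :> g x" for x
      unfolding \<Phi>_def[abs_def] g_def using assms(5) S.smoothed_gderiv by (rule GDERIV_add)
    show "l-lipschitz_on UNIV g"
      unfolding l g_def[abs_def] using assms(7) S.smoothed_gradient_lipschitz by (rule lipschitz_on_add)
  qed
  have "(\<lambda>x. transpose A *v v_smooth A Q d \<mu> x) \<in> borel_measurable borel"
    using S.smoothed_gradient_lipschitz
    by (intro borel_measurable_continuous_onI lipschitz_on_continuous_on)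
  from borel_measurable_add[OF assms(19) measurable_compose[OF measurable_fst this]]
  have H_measurable: "(\<lambda>(x, s). H x s) \<in> borel_measurable (borel \<Otimes>\<^sub>M P)"
    by (simp add: H_def case_prod_unfold)
  have error: "g x - H x s = grad_f x - G x s" for x s by (simp add: g_def H_def)
  have samples: "{0..N} = {..<Suc N}" by auto
  interpret R: accelerated_run \<Phi> g l \<Omega> P H \<sigma> B 0 \<xi> "Suc N"
  proof (intro accelerated_run.intro smooth \<Omega>.prob_space_axioms accelerated_run_axioms.intro)
    show "(\<lambda>(x, s). H x s) \<in> borel_measurable (borel \<Otimes>\<^sub>M P)" by (fact H_measurable)
    show "integrable P (H x)" for x
      unfolding H_def[abs_def] using assms(20) by simp
    show "(\<integral>s. H x s \<partial>P) = g x" for x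
      unfolding H_def g_def using assms(20,21) by (simp add: P.prob_space)
    show "integrable P (\<lambda>s. (norm (g x - H x s))\<^sup>2)" for x
      unfolding error by (rule assms(23))
    show "(\<integral>s. (norm (g x - H x s))\<^sup>2 \<partial>P) \<le> \<sigma>\<^sup>2" for x
      unfolding error by (rule assms(24))
    show "\<Omega>.indep_vars (\<lambda>_. P) \<xi> {..<Suc N}"
      using assms(28) unfolding samples .
    show "distr \<Omega> P (\<xi> t) = P" if "t < Suc N" for t
      using that by (intro assms(29)) simp
    show "0 < B" "l \<le> B" using l_pos by (simp_all add: B_def add_nonneg_pos)
  qed
  have "ssg A Q d c G N L \<mu> (\<lambda>i. \<xi> i \<omega>) (N + 1) = trajectory B H 0 (\<lambda>i. \<xi> i \<omega>) (N + 1)" for \<omega>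
    using ssg_eq_trajectory[OF l_pos[unfolded l_def], of Q d G N]
    unfolding B_def l_def H_def[abs_def] by blast
  then have X_eq: "X \<omega> = fst (R.state (Suc N) \<omega>)" for \<omega>
    by (simp only: X_def ssg_output_def R.state_def Suc_eq_plus1)
  \<comment> \<open>The smoothed objective lies below the original one, by at most \<open>\<mu> M\<close>; each of the two bounds is
    used at one of the two points compared.\<close>
  have lower: "\<Phi> x_opt \<le> \<phi> x_opt"
    using S.smoothed_le_support[OF assms(15), of x_opt] by (simp add: \<Phi>_def assms(12,13))
  have upper: "\<phi> x \<le> \<Phi> x + \<mu> * M" for x
    using S.support_le_smoothed[of x] by (simp add: \<Phi>_def assms(12,13,18))
  have \<Phi>_int: "integrable \<Omega> (\<lambda>\<omega>. \<Phi> (X \<omega>))"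
    using R.expected_suboptimality(1)[of N] by (simp add: X_eq)
  have "continuous_on UNIV f"
    using assms(5) unfolding gderiv_def
    by (meson continuous_at_imp_continuous_on has_derivative_continuous)
  moreover have "continuous_on UNIV h"
    using assms(9,8,12) by (rule support_function_continuous)
  ultimately have "\<phi> \<in> borel_measurable borel"
    unfolding assms(13)[abs_def] by (intro borel_measurable_continuous_onI continuous_on_add)
  moreover have "X \<in> borel_measurable \<Omega>"
    using R.square_integrable_state[of "Suc N"] by (simp add: X_eq[abs_def] square_integrable_def)
  ultimately have meas: "(\<lambda>\<omega>. \<phi> (X \<omega>)) \<in> borel_measurable \<Omega>"
    using measurable_compose by blast
  have "integrable \<Omega> (\<lambda>\<omega>. \<phi> (X \<omega>) - \<phi> x_opt)"
  proof (rule integrable_dominated)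
    show "integrable \<Omega> (\<lambda>\<omega>. \<Phi> (X \<omega>) + \<mu> * M - \<phi> x_opt)" using \<Phi>_int by simp
    show "(\<lambda>\<omega>. \<phi> (X \<omega>) - \<phi> x_opt) \<in> borel_measurable \<Omega>" using meas by simp
  qed (use assms(25) upper in simp_all)
  from Bochner_Integration.integrable_add[OF this \<Omega>.integrable_const[of "\<phi> x_opt"]]
  have \<phi>_int: "integrable \<Omega> (\<lambda>\<omega>. \<phi> (X \<omega>))" by simp
  have "(\<integral>\<omega>. \<phi> (X \<omega>) \<partial>\<Omega>) \<le> (\<integral>\<omega>. \<Phi> (X \<omega>) + \<mu> * M \<partial>\<Omega>)"
    using \<phi>_int \<Phi>_int upper by (intro integral_mono) auto
  also have "\<dots> = (\<integral>\<omega>. \<Phi> (X \<omega>) \<partial>\<Omega>) + \<mu> * M"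
    using \<Phi>_int by (simp add: \<Omega>.prob_space)
  finally have smoothing_gap: "(\<integral>\<omega>. \<phi> (X \<omega>) \<partial>\<Omega>) - \<phi> x_opt
      \<le> ((\<integral>\<omega>. \<Phi> (X \<omega>) \<partial>\<Omega>) - \<Phi> x_opt) + \<mu> * M"
    using lower by simp
  have "real N powr (3/2) = real N * sqrt (real N)"
    using \<open>N \<ge> 1\<close> powr_add[of "real N" 1 "1/2"] by (simp add: powr_half_sqrt)
  then have B_eq: "B = real N * sqrt (real N) + 2 * l" by (simp add: B_def)
  have "(\<integral>\<omega>. \<Phi> (X \<omega>) \<partial>\<Omega>) - \<Phi> x_opt
      \<le> (2 * D\<^sup>2 + \<sigma>\<^sup>2) / sqrt (real N + 2) + 4 * l * D\<^sup>2 / (real N + 2)\<^sup>2"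
  proof (rule rate_arithmetic)
    show "weight (Suc N) * ((\<integral>\<omega>. \<Phi> (X \<omega>) \<partial>\<Omega>) - \<Phi> x_opt)
      \<le> (real N * sqrt (real N) + 2 * l) / 2 * D\<^sup>2
        + real N * (real N + 1) * (real N + 5) / 12
            * ((real N * sqrt (real N) + 2 * l + l) / (2 * (real N * sqrt (real N) + 2 * l)\<^sup>2)) * \<sigma>\<^sup>2
        + weight (Suc N) * l / (2 * (real N * sqrt (real N) + 2 * l)\<^sup>2) * \<sigma>\<^sup>2"
      using R.expected_suboptimality(2)[of N x_opt] assms(31)
      unfolding B_eq[symmetric] X_eq by simp
  qed (use assms l_pos in simp_all)
  also have "4 * l * D\<^sup>2 / (real N + 2)\<^sup>2
      = L * (4 * D\<^sup>2 / (real N + 2)\<^sup>2) + spectral_norm A / (real N + 2) * (4 * D\<^sup>2 / c)"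
  proof -
    have "(spectral_norm A)\<^sup>2 / (c * \<mu>) = spectral_norm A * (real N + 2) / c"
      using A_pos assms(30) by (simp add: power2_eq_square)
    moreover have "4 * (L + a * m / c) * x / m\<^sup>2 = L * (4 * x / m\<^sup>2) + a / m * (4 * x / c)"
      if "m > 0" for a m x :: real
      using that \<open>c > 0\<close> by (simp add: field_simps power2_eq_square)
    ultimately show ?thesis
      unfolding l by simp
  qed
  finally have "(\<integral>\<omega>. \<phi> (X \<omega>) \<partial>\<Omega>) - \<phi> x_opt \<le> (2 * D\<^sup>2 + \<sigma>\<^sup>2) / (real N + 2) powr (1/2)
        + L * (4 * D\<^sup>2 / (real N + 2)\<^sup>2) + spectral_norm A / (real N + 2) * (M + 4 * D\<^sup>2 / c)"
    using smoothing_gap assms(30) by (simp add: powr_half_sqrt distrib_left)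
  also have "\<dots> \<le> (2 * D\<^sup>2 + \<sigma>\<^sup>2) / (real N + 2) powr (1/2)
        + L * ((4 * D\<^sup>2 + 2 * \<sigma>\<^sup>2) / (real N + 2)\<^sup>2)
        + spectral_norm A / (real N + 2) * (M + (4 * D\<^sup>2 + 2 * \<sigma>\<^sup>2) / c)"
    using \<open>L > 0\<close> \<open>c > 0\<close> A_pos
    by (intro add_mono mult_left_mono order_refl divide_right_mono) auto
  finally show ?thesis using \<phi>_int unfolding X_def by blast
qed

end
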